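(* Let $h(x;a,b)=\frac{b^a}{\Gamma(a)}x^{-a-1}e^{-b/x}$, $x>0$, $a>0$, $b>0$, be the inverse gamma density, and let $K(x;k,z)=h(x;k,kz)$, $k>0$, $z>0$. Let $\Pi$ be a prior on $\mathscr{M}(\mathbb{R}^+\times\mathbb{R}^+)$, and let $\Pi^*$ be the prior induced by $\Pi$ on densities via $P\mapsto f_P$, $f_P(x)=\int K(x;k,z)\,dP(k,z)$. Assume that the weak support of $\Pi$ contains $\mathscr{M}(\mathbb{R}^+\times\mathbb{R}^+)$. Let $f_0$ be a continuous and bounded density on $[0,\infty)$ satisfying (B4) for some $0<M<\infty$, $0<f_0(x)\le M$ for all $x>0$; (B5) $\left|\int f_0(x)\log f_0(x)\,dx\right|<\infty$; (B6* ) $\int f_0(x)\log\frac{f_0(x)}{\phi_\delta(x)}\,dx<\infty$ for some $\delta>0$, where $\phi_\delta(x)=\inf_{t\in[x,x+\delta)}f_0(t)$ for $0<x<1$ and $\phi_\delta(x)=\inf_{t\in(x-\delta,x]}f_0(t)$ for $x\ge1$; (B7* ) there exists $\eta>0$ such that $\int\max(x^{-\eta-2},x^{\eta+2})f_0(x)\,dx<\infty$. Then $f_0\in\mathrm{KL}(\Pi^* )$.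
   Context: $\mathbb{R}^+=(0,\infty)$. $\mathscr{M}(S)$ is the set of probability measures on $S$; a prior is a probability measure on the indicated space; the weak support of a prior on $\mathscr{M}(S)$ is its support in the topology of weak convergence. Infima are over points $t$ in the domain of $f_0$. $f_0\in\mathrm{KL}(\Pi^* )$ means $\Pi^*(\{f:\int f_0\log(f_0/f)<\epsilon\})>0$ for every $\epsilon>0$. *)

theory Defs
  imports "HOL-Probability.Probability"
begin

definition prob_measures :: "'a::topological_space set \<Rightarrow> 'a measure set" where
  "prob_measures S = {P. prob_space P \<and> sets P = sets (restrict_space borel S)}"

text \<open>
  The topology of weak convergence: the coarsest topology on the probability measures on \<open>S\<close> that
  makes \<open>P \<mapsto> \<integral>g dP\<close> continuous for every bounded continuous \<open>g\<close> on \<open>S\<close>.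
\<close>

definition weak_topology :: "'a::topological_space set \<Rightarrow> 'a measure topology" where
  "weak_topology S = topology_generated_by
     {{P \<in> prob_measures S. (\<integral>x. g x \<partial>P) \<in> U} | (g :: 'a \<Rightarrow> real) U.
        continuous_on S g \<and> bounded (g ` S) \<and> open U}"

text \<open>
  Priors live on the Borel sigma-algebra of the weak topology, so the neighbourhoods in the
  definition of the support are measurable.
\<close>

definition is_prior :: "'a::topological_space set \<Rightarrow> 'a measure measure \<Rightarrow> bool" where
  "is_prior S Q \<longleftrightarrow>
     prob_space Q \<and> space Q = prob_measures S \<and>
     sets Q = sigma_sets (prob_measures S) {U. openin (weak_topology S) U}"

definition weak_support :: "'a::topological_space set \<Rightarrow> 'a measure measure \<Rightarrow> 'a measure set" where
  "weak_support S Q =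
     {P \<in> prob_measures S. \<forall>U. openin (weak_topology S) U \<and> P \<in> U \<longrightarrow> emeasure Q U > 0}"

abbreviation pos_lborel :: "real measure" where
  "pos_lborel \<equiv> restrict_space lborel {0<..}"

text \<open>
  Densities take values in \<^typ>\<open>ennreal\<close> because a mixture may be infinite on a null set.
  Values at nonpositive arguments are irrelevant throughout.
\<close>

definition densities :: "(real \<Rightarrow> ennreal) set" where
  "densities = {f \<in> borel_measurable pos_lborel. (\<integral>\<^sup>+x. f x \<partial>pos_lborel) = 1}"

definition inverse_gamma_density :: "real \<Rightarrow> real \<Rightarrow> real \<Rightarrow> real" where
  "inverse_gamma_density x a b = b powr a / Gamma a * x powr (- a - 1) * exp (- b / x)"

definition inverse_gamma_kernel :: "real \<Rightarrow> real \<Rightarrow> real \<Rightarrow> real" where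
  "inverse_gamma_kernel x k z = inverse_gamma_density x k (k * z)"

definition mixture :: "(real \<times> real) measure \<Rightarrow> real \<Rightarrow> ennreal" where
  "mixture P x = (\<integral>\<^sup>+(k, z). ennreal (inverse_gamma_kernel x k z) \<partial>P)"

text \<open>
  The image of \<open>Q\<close> under \<^const>\<open>mixture\<close>, on the largest sigma-algebra on \<^const>\<open>densities\<close> that makes
  this map measurable: a set of densities is measurable iff its preimage is.
\<close>

definition induced_prior :: "(real \<times> real) measure measure \<Rightarrow> (real \<Rightarrow> ennreal) measure" where
  "induced_prior Q =
     distr Q (sigma densities {A. A \<subseteq> densities \<and> mixture -` A \<inter> space Q \<in> sets Q}) mixture"

text \<open>
  The integral of an extended real function as positive part minus negative part
  (\<^const>\<open>e2ennreal\<close> sends negative numbers to 0). The Bochner integral would return 0 where the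
  integral is infinite. The undefined case \<open>\<infinity> - \<infinity>\<close> comes out as \<open>\<infinity>\<close>.
\<close>

definition ereal_integral :: "'a measure \<Rightarrow> ('a \<Rightarrow> ereal) \<Rightarrow> ereal" where
  "ereal_integral M g =
     enn2ereal (\<integral>\<^sup>+x. e2ennreal (g x) \<partial>M) - enn2ereal (\<integral>\<^sup>+x. e2ennreal (- g x) \<partial>M)"

function ereal_ln :: "ereal \<Rightarrow> ereal" where
  "ereal_ln (ereal r) = (if r \<le> 0 then - \<infinity> else ereal (ln r))"
| "ereal_ln \<infinity> = \<infinity>"
| "ereal_ln (- \<infinity>) = - \<infinity>"
  by (auto intro: ereal_cases)
termination by lexicographic_order

text \<open>
  The arithmetic of \<^typ>\<open>ereal\<close> gives the usual conventions: for \<open>p > 0\<close> the integrand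
  \<open>p * log (p / q)\<close> is \<open>\<infinity>\<close> where \<open>q = 0\<close>, and it is 0 where \<open>p = 0\<close>.
\<close>

definition log_ratio_integral :: "(real \<Rightarrow> real) \<Rightarrow> (real \<Rightarrow> ereal) \<Rightarrow> ereal" where
  "log_ratio_integral p q =
     ereal_integral pos_lborel (\<lambda>x. ereal (p x) * ereal_ln (ereal (p x) / q x))"

definition KL_support :: "(real \<Rightarrow> ennreal) measure \<Rightarrow> (real \<Rightarrow> real) set" where
  "KL_support Q =
     {p. \<forall>\<epsilon>::real. \<epsilon> > 0 \<longrightarrow>
        emeasure Q {f \<in> space Q. log_ratio_integral p (\<lambda>x. enn2ereal (f x)) < ereal \<epsilon>} > 0}"

text \<open>The infima range over the domain \<open>[0,\<infinity>)\<close> of \<open>f\<close>; this matters only when \<open>x - \<delta> < 0\<close>.\<close>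

definition local_inf :: "(real \<Rightarrow> real) \<Rightarrow> real \<Rightarrow> real \<Rightarrow> real" where
  "local_inf f \<delta> x =
     (if x < 1 then (INF t \<in> {x..<x + \<delta>} \<inter> {0..}. f t) else (INF t \<in> {x - \<delta><..x} \<inter> {0..}. f t))"

end

theory Submission
  imports Defs "HOL-Real_Asymp.Real_Asymp"
begin

text \<open>
  The divergence of \<open>f\<^sub>P\<close> from \<open>f\<^sub>0\<close> is at most \<open>\<integral> f\<^sub>0 log\<^sup>+ (f\<^sub>0 / f\<^sub>P)\<close>, so only lower bounds for the
  mixtures \<open>f\<^sub>P\<close> matter. Fix \<open>\<epsilon>\<close>, put \<open>e = exp (- \<epsilon> / 2)\<close>, and let \<open>P\<^sub>n\<close> be the mixing measure that
  has an atom of mass \<open>1 - e\<close> at \<open>(3/2, 3/2)\<close> and distributes the remaining mass over the line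
  \<open>k = n\<close>, with \<open>z\<close> following \<open>f\<^sub>0\<close>.

  As a function of \<open>z\<close>, the kernel \<open>K(x; n, z)\<close> is a gamma density that concentrates at \<open>x\<close> as \<open>n\<close>
  grows, so the part of the mixture that comes from the line has a lower limit of at least
  \<open>e f\<^sub>0(x)\<close> by continuity (\<open>inverse_gamma_kernel_smoothing_limit\<close>). The atom keeps the mixture
  above a fixed multiple of \<open>exp (- 3 x - 7 / x)\<close>. The moment condition makes \<open>x\<close> and \<open>1 / x\<close>
  integrable against \<open>f\<^sub>0\<close>, so dominated convergence applies and \<open>\<integral> f\<^sub>0 log\<^sup>+ (f\<^sub>0 / f\<^sub>P)\<close>
  falls below \<open>\<epsilon>\<close> along \<open>P = P\<^sub>n\<close>, since \<open>log (1 / e) = \<epsilon> / 2\<close>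
  (\<open>nn_integral_log_ratio_eventually_less\<close>).

  Both lower bounds persist, with a small loss, for every \<open>P\<close> in a weak neighbourhood of \<open>P\<^sub>n\<close>
  (\<open>weak_neighborhood_mixture_lower_bound\<close>): the first one is needed only on \<open>[1 / n, n]\<close>, and there,
  once the kernel is cut off to a compact set of parameters, finitely many test integrals control
  all \<open>x\<close> at once; the second one needs a single test integral, which keeps some mass near the atom.
  Full weak support gives this neighbourhood positive prior probability.

  Finally the set of densities with divergence below \<open>\<epsilon>\<close> must be an event of the induced prior.
  This follows from the joint measurability of \<open>(P, x) \<mapsto> f\<^sub>P(x)\<close>, because the Borel sets of the weak
  topology make all maps \<open>P \<mapsto> P(A)\<close> measurable (\<open>log_ratio_integral_mixture_measurable\<close>).
\<close>

section \<open>The inverse gamma kernel\<close>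

lemma sigma_finite_pos_lborel: "sigma_finite_measure pos_lborel"
  by (rule sigma_finite_measure_restrict_space) (auto simp: lborel.sigma_finite_measure_axioms)

lemma nn_integral_pos_lborel:
  "(\<integral>\<^sup>+x. f x \<partial>pos_lborel) = (\<integral>\<^sup>+x. f x * indicator {0<..} x \<partial>lborel)"
  by (simp add: nn_integral_restrict_space)

lemma borel_measurable_pos_lborel:
  fixes f :: "real \<Rightarrow> real"
  assumes "continuous_on {0<..} f"
  shows "f \<in> borel_measurable pos_lborel"
  using borel_measurable_continuous_on_restrict[OF assms]
    sets_restrict_space_cong[of lborel borel "{0<..}"] by (simp cong: measurable_cong_sets)

abbreviation (input) quadrant :: "(real \<times> real) set" where
  "quadrant \<equiv> {0<..} \<times> {0<..}"

lemma inverse_gamma_kernel_eq: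
  "inverse_gamma_kernel x k z = (k * z) powr k / Gamma k * x powr (- k - 1) * exp (- (k * z) / x)"
  by (simp add: inverse_gamma_kernel_def inverse_gamma_density_def)

lemma inverse_gamma_kernel_nonneg: "k > 0 \<Longrightarrow> inverse_gamma_kernel x k z \<ge> 0"
  by (simp add: inverse_gamma_kernel_eq Gamma_real_nonneg)

lemma continuous_on_inverse_gamma_kernel:
  "continuous_on ({0<..} \<times> quadrant) (\<lambda>(x, k, z). inverse_gamma_kernel x k z)"
proof -
  have "Gamma k \<noteq> 0" if "k > 0" for k :: real
    using Gamma_real_pos[OF that] by simp
  moreover have "continuous_on ({0<..} \<times> quadrant) (\<lambda>p. Gamma (fst (snd p)))"
    by (rule continuous_on_compose2[of "{0<..}" Gamma])
      (auto intro!: continuous_intros elim!: nonpos_Ints_cases)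
  ultimately show ?thesis
    unfolding inverse_gamma_kernel_eq case_prod_beta
    by (intro continuous_intros) auto
qed

lemma inverse_gamma_kernel_measurable:
  "(\<lambda>(x, k, z). inverse_gamma_kernel x k z) \<in>
     borel_measurable (pos_lborel \<Otimes>\<^sub>M restrict_space borel quadrant)"
proof -
  have "(\<lambda>p. p) \<in> pos_lborel \<Otimes>\<^sub>M restrict_space borel quadrant \<rightarrow>\<^sub>M
      restrict_space (borel :: (real \<times> real \<times> real) measure) ({0<..} \<times> quadrant)"
  proof (rule measurable_restrict_space2)
    have "fst \<in> borel_measurable (pos_lborel \<Otimes>\<^sub>M restrict_space borel quadrant)"
      by (rule measurable_compose[OF measurable_fst]) (simp add: measurable_restrict_space1)
    moreover have "snd \<in> borel_measurable (pos_lborel \<Otimes>\<^sub>M restrict_space borel quadrant)"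
      by (rule measurable_compose[OF measurable_snd]) (simp add: measurable_restrict_space1)
    ultimately show "(\<lambda>p. p) \<in> borel_measurable (pos_lborel \<Otimes>\<^sub>M restrict_space borel quadrant)"
      using borel_measurable_Pair[of fst _ snd] by simp
  qed (auto simp: space_pair_measure space_restrict_space)
  from measurable_compose[OF this
      borel_measurable_continuous_on_restrict[OF continuous_on_inverse_gamma_kernel]]
  show ?thesis .
qed

text \<open>
  The substitution \<open>x \<mapsto> b / x\<close> turns the integral into the Gamma integral.
\<close>

lemma nn_integral_inverse_gamma_density:
  assumes "a > 0" "b > 0"
  shows "(\<integral>\<^sup>+x. ennreal (inverse_gamma_density x a b) \<partial>pos_lborel) = 1"
proof -
  define f where "f = (\<lambda>t. t powr (a - 1) / exp (t :: real))"
  have G: "Gamma a > 0"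
    using assms by (simp add: Gamma_real_pos)
  have "(f has_integral Gamma a) {0<..}"
    using has_integral_interior[of "{0::real..}" f] Gamma_integral_real[OF assms(1), folded f_def]
    by (simp add: negligible_convex_frontier)
  then have "f absolutely_integrable_on {0<..} \<and> integral {0<..} f = Gamma a"
    by (auto simp: f_def absolutely_integrable_on_iff_nonneg integral_unique integrable_on_def)
  moreover have "(\<lambda>x. b / x) ` {0<..} = {0<..}"
  proof safe
    fix y :: real assume "y > 0"
    then show "y \<in> (\<lambda>x. b / x) ` {0<..}"
      using assms by (intro image_eqI[of _ _ "b / y"]) auto
  qed (use assms in auto)
  moreover have "((\<lambda>x. b / x) has_field_derivative - b / x\<^sup>2) (at x within {0<..})"
    if "x \<in> {0<..}" for x
    using that by (auto intro!: derivative_eq_intros simp: power2_eq_square)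
  moreover have "inj_on (\<lambda>x. b / x) {0<..}"
    using assms by (auto simp: inj_on_def field_simps)
  ultimately have *: "(\<lambda>x. \<bar>- b / x\<^sup>2\<bar> * f (b / x)) absolutely_integrable_on {0<..} \<and>
      integral {0<..} (\<lambda>x. \<bar>- b / x\<^sup>2\<bar> * f (b / x)) = Gamma a"
    by (subst has_absolute_integral_change_of_variables_1') auto
  then have "((\<lambda>x. \<bar>- b / x\<^sup>2\<bar> * f (b / x)) has_integral Gamma a) {0<..}"
    by (auto simp only: has_integral_iff absolutely_integrable_on_def)
  then have int: "((\<lambda>x. \<bar>- b / x\<^sup>2\<bar> * f (b / x) / Gamma a) has_integral Gamma a / Gamma a) {0<..}"
    by (rule has_integral_divide)
  have eq: "\<bar>- b / x\<^sup>2\<bar> * f (b / x) / Gamma a = inverse_gamma_density x a b" if "x > 0" for x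
  proof -
    have "b powr a * x powr (- a - 1) = b powr (a - 1) * b * (x powr (1 - a) / x\<^sup>2)"
      using that assms by (simp add: powr_diff powr_minus power2_eq_square field_simps)
    also have "\<dots> = b / x\<^sup>2 * (b / x) powr (a - 1)"
      using that assms by (simp add: powr_divide powr_diff field_simps)
    finally show ?thesis
      using assms G by (simp add: inverse_gamma_density_def f_def exp_minus field_simps abs_mult)
  qed
  have "((\<lambda>x. inverse_gamma_density x a b) has_integral 1) {0<..}"
    using G has_integral_eq[OF eq int] by simp
  from nn_integral_has_integral_lebesgue'[OF _ this] show ?thesis
    using assms G
    by (simp add: nn_integral_restrict_space inverse_gamma_density_def)
qed

text \<open>
  In the scale variable \<open>z\<close> the kernel is a gamma density, with mean \<open>(n + 1) x / n\<close> and variance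
  \<open>(n + 1) x\<^sup>2 / n\<^sup>2\<close>; this is why large shape parameters reproduce a continuous density.
\<close>

lemma inverse_gamma_kernel_eq_erlang_density:
  assumes "x > 0" "z > 0" "n > 0"
  shows "inverse_gamma_kernel x (real n) z = erlang_density n (real n / x) z"
proof -
  obtain m where n: "n = Suc m" using assms(3) gr0_conv_Suc by blast
  have G: "Gamma (real n) = fact m"
    unfolding n using Gamma_fact[of m, where 'a = real] by (simp add: add.commute)
  have "x powr (- real n - 1) = 1 / x ^ Suc n"
    using assms by (simp add: powr_diff powr_minus powr_realpow field_simps)
  moreover have "(real n * z) powr real n = real n ^ n * z ^ n"
    using assms by (simp add: powr_realpow power_mult_distrib)
  moreover have "fact n = real n * fact m"
    by (simp add: n)
  ultimately show ?thesis
    using assms by (simp add: inverse_gamma_kernel_eq erlang_density_def G power_divide field_simps)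
qed

lemma nn_integral_erlang_density_square_deviation:
  assumes x: "x > 0" and n: "n > 0"
  shows "(\<integral>\<^sup>+z. ennreal (erlang_density n (real n / x) z * (z - x)\<^sup>2) \<partial>lborel) =
           ennreal (x\<^sup>2 * (real n + 2) / (real n)\<^sup>2)"
proof -
  let ?e = "erlang_density n (real n / x)"
  have l: "real n / x > 0" using assms by simp
  \<comment> \<open>The moments of order 0, 1 and 2 determine the square deviation from any point.\<close>
  have hb: "has_bochner_integral lborel (\<lambda>z. ?e z * z ^ i) (fact (n + i) / (fact n * (real n / x) ^ i))" for i
  proof (rule has_bochner_integral_nn_integral)
    have "?e z * z ^ i \<ge> 0" for z
    proof (cases "z < 0")
      case False
      then show ?thesis
        using l by (intro mult_nonneg_nonneg erlang_density_nonneg) auto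
    qed (simp add: erlang_density_def)
    then show "AE z in lborel. 0 \<le> ?e z * z ^ i" by simp
  qed (use nn_integral_erlang_ith_moment[OF l, of n i] l in auto)
  have "has_bochner_integral lborel (\<lambda>z. ?e z * z ^ 2 - 2 * x * (?e z * z ^ 1) + x\<^sup>2 * (?e z * z ^ 0))
     (fact (n + 2) / (fact n * (real n / x) ^ 2) - 2 * x * (fact (n + 1) / (fact n * (real n / x) ^ 1))
       + x\<^sup>2 * (fact (n + 0) / (fact n * (real n / x) ^ 0)))"
    by (intro has_bochner_integral_add has_bochner_integral_diff has_bochner_integral_mult_right hb)
  also have "(\<lambda>z. ?e z * z ^ 2 - 2 * x * (?e z * z ^ 1) + x\<^sup>2 * (?e z * z ^ 0)) = (\<lambda>z. ?e z * (z - x)\<^sup>2)"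
    by (auto simp: power2_eq_square algebra_simps)
  also have "fact (n + 2) / (fact n * (real n / x) ^ 2) - 2 * x * (fact (n + 1) / (fact n * (real n / x) ^ 1))
       + x\<^sup>2 * (fact (n + 0) / (fact n * (real n / x) ^ 0)) = x\<^sup>2 * (real n + 2) / (real n)\<^sup>2"
    using assms by (simp add: field_simps power2_eq_square)
  finally show ?thesis
    using l by (subst nn_integral_eq_integral)
      (auto simp: has_bochner_integral_iff)
qed

section \<open>Weak topology and measurability of evaluations\<close>

lemma prob_measuresD:
  assumes "P \<in> prob_measures S"
  shows "prob_space P" "sets P = sets (restrict_space borel S)" "space P = S"
  using assms sets_eq_imp_space_eq[of P "restrict_space borel S"]
  by (auto simp: prob_measures_def space_restrict_space)

lemma borel_measurable_prob_measures:
  fixes g :: "'a::topological_space \<Rightarrow> real"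
  assumes "P \<in> prob_measures S" "continuous_on S g"
  shows "g \<in> borel_measurable P"
  using borel_measurable_continuous_on_restrict[OF assms(2)] prob_measuresD(2)[OF assms(1)]
  by (simp cong: measurable_cong_sets)

lemma integrable_prob_measures:
  fixes g :: "'a::topological_space \<Rightarrow> real"
  assumes "P \<in> prob_measures S" "continuous_on S g" "bounded (g ` S)"
  shows "integrable P g"
proof -
  interpret P: prob_space P using prob_measuresD(1)[OF assms(1)] .
  obtain B where "\<And>x. x \<in> S \<Longrightarrow> norm (g x) \<le> B"
    using assms(3) by (auto simp: bounded_iff)
  then show ?thesis
    using prob_measuresD(3)[OF assms(1)] borel_measurable_prob_measures[OF assms(1,2)]
    by (intro P.integrable_const_bound[of _ B]) auto
qed

lemma openin_weak_topology_integral: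
  fixes g :: "'a::topological_space \<Rightarrow> real"
  assumes "continuous_on S g" "bounded (g ` S)" "open U"
  shows "openin (weak_topology S) {P \<in> prob_measures S. (\<integral>x. g x \<partial>P) \<in> U}"
  unfolding weak_topology_def openin_topology_generated_by_iff
  using assms by (intro generate_topology_on.Basis) blast

lemma sets_restrict_space_borel:
  fixes S :: "'a::topological_space set"
  assumes "S \<in> sets borel"
  shows "sets (restrict_space borel S) = sigma_sets S ((\<inter>) S ` {U. open U})"
  using sigma_sets_Int[of S UNIV "{U. open U}"] assms
  by (simp add: sets_restrict_space borel_def)

text \<open>
  The Borel sets of the weak topology are fine enough to make every evaluation \<open>P \<mapsto> P(A)\<close>
  measurable: for open \<open>A\<close> it is a limit of integrals of the continuous functions
  \<open>min 1 (n d(x, - A))\<close>, and the open sets form a generating system closed under intersection.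
\<close>

lemma prior_measurable_subprob_algebra:
  fixes S :: "'a::metric_space set"
  assumes S: "S \<in> sets borel" and prior: "is_prior S Q"
  shows "(\<lambda>P. P) \<in> Q \<rightarrow>\<^sub>M subprob_algebra (restrict_space borel S)"
proof (rule measurable_subprob_algebra_generated[OF sets_restrict_space_borel[OF S]])
  have space: "space Q = prob_measures S"
    using prior by (simp add: is_prior_def)
  show "Int_stable ((\<inter>) S ` {U :: 'a set. open U})"
  proof (rule Int_stableI_image)
    fix U V :: "'a set" assume "U \<in> {U. open U}" "V \<in> {U. open U}"
    then show "\<exists>W\<in>{U. open U}. S \<inter> U \<inter> (S \<inter> V) = S \<inter> W"
      by (intro bexI[of _ "U \<inter> V"]) auto
  qed
  show "(\<inter>) S ` {U :: 'a set. open U} \<subseteq> Pow S"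
    by auto
  show "subprob_space P" "sets P = sets (restrict_space borel S)" if "P \<in> space Q" for P
    using prob_measuresD[of P S] that space by (auto simp: prob_space_imp_subprob_space)
  have one: "(\<lambda>P. emeasure P S) \<in> borel_measurable Q"
  proof -
    have "emeasure P S = 1" if "P \<in> space Q" for P
      using prob_measuresD[of P S] that space prob_space.emeasure_space_1 by metis
    then show ?thesis
      by (simp cong: measurable_cong)
  qed
  then show "(\<lambda>P. emeasure P S) \<in> borel_measurable Q" .
  fix A assume "A \<in> (\<inter>) S ` {U :: 'a set. open U}"
  then obtain U where U: "open U" "A = S \<inter> U" by auto
  show "(\<lambda>P. emeasure P A) \<in> borel_measurable Q"
  \<comment> \<open>The distance to the empty set is 0 by convention, so the whole space is treated apart.\<close>
  proof (cases "U = UNIV")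
    case True
    then show ?thesis using one U by simp
  next
    case False
    define g where "g = (\<lambda>n x. min 1 (real n * infdist x (- U)))"
    have g: "continuous_on S (g n)" "bounded (g n ` S)" "\<bar>g n x\<bar> \<le> 1" for n x
      by (auto simp: g_def infdist_nonneg bounded_iff intro!: continuous_intros exI[of _ 1])
    have lim: "(\<lambda>n. g n x) \<longlonglongrightarrow> indicator U x" for x
    proof (cases "x \<in> U")
      case True
      then have "infdist x (- U) > 0"
        using U False in_closed_iff_infdist_zero[of "- U" x] infdist_nonneg[of x "- U"]
        by (auto simp: closed_def less_le)
      then obtain N :: nat where N: "1 < real N * infdist x (- U)"
        using reals_Archimedean3 by blast
      have "eventually (\<lambda>n. g n x = 1) sequentially"
        using eventually_ge_at_top[of N]
      proof eventually_elim
        case (elim n)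
        then have "real N * infdist x (- U) \<le> real n * infdist x (- U)"
          by (intro mult_right_mono infdist_nonneg) auto
        with N show ?case by (simp add: g_def)
      qed
      then show ?thesis using True by (simp add: tendsto_eventually)
    next
      case False
      then show ?thesis by (simp add: g_def)
    qed
    have "(\<lambda>P. \<integral>x. g n x \<partial>P) \<in> borel_measurable Q" for n
    proof (rule borel_measurableI)
      fix V :: "real set" assume "open V"
      have "(\<lambda>P. \<integral>x. g n x \<partial>P) -` V \<inter> space Q = {P \<in> prob_measures S. (\<integral>x. g n x \<partial>P) \<in> V}"
        using space by auto
      also have "\<dots> \<in> sets Q"
        using openin_weak_topology_integral[OF g(1,2) \<open>open V\<close>] prior
        by (auto simp: is_prior_def intro: sigma_sets.Basic)
      finally show "(\<lambda>P. \<integral>x. g n x \<partial>P) -` V \<inter> space Q \<in> sets Q" .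
    qed
    moreover have "(\<lambda>n. \<integral>x. g n x \<partial>P) \<longlonglongrightarrow> measure P A" if "P \<in> space Q" for P
    proof -
      have P: "P \<in> prob_measures S" using that space by simp
      interpret P: prob_space P using prob_measuresD(1)[OF P] .
      have A: "A \<in> sets P"
        using prob_measuresD(2)[OF P] U by (auto simp: sets_restrict_space)
      have "(indicator U :: 'a \<Rightarrow> real) \<in> borel_measurable P"
        using measurable_restrict_space1[of "indicator U :: 'a \<Rightarrow> real" borel borel S] U
          prob_measuresD(2)[OF P] by (simp cong: measurable_cong_sets)
      then have "(\<lambda>n. \<integral>x. g n x \<partial>P) \<longlonglongrightarrow> (\<integral>x. indicator U x \<partial>P)"
        using g lim borel_measurable_prob_measures[OF P g(1)]
        by (intro integral_dominated_convergence[where w = "\<lambda>_. 1"]) auto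
      also have "(\<integral>x. indicator U x \<partial>P) = (\<integral>x. indicator A x \<partial>P)"
        using prob_measuresD(3)[OF P] U by (intro Bochner_Integration.integral_cong) (auto simp: indicator_def)
      finally show ?thesis
        using A by (simp add: P.emeasure_eq_measure)
    qed
    ultimately have "(\<lambda>P. measure P A) \<in> borel_measurable Q"
      by (rule borel_measurable_LIMSEQ_real[rotated])
    then have "(\<lambda>P. ennreal (measure P A)) \<in> borel_measurable Q"
      by measurable
    moreover have "ennreal (measure P A) = emeasure P A" if "P \<in> space Q" for P
      using prob_measuresD(1)[of P S] that space
      by (simp add: prob_space_def finite_measure.emeasure_eq_measure)
    ultimately show ?thesis
      by (simp cong: measurable_cong)
  qed
qed

section \<open>Measurability of the divergence and the induced prior\<close>

lemma mixture_eq: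
  "mixture P x = (\<integral>\<^sup>+s. ennreal (inverse_gamma_kernel x (fst s) (snd s)) \<partial>P)"
  by (simp add: mixture_def case_prod_beta')

lemma mixture_jointly_measurable:
  assumes "is_prior quadrant Q"
  shows "(\<lambda>(P, x). mixture P x) \<in> borel_measurable (Q \<Otimes>\<^sub>M pos_lborel)"
proof -
  let ?R = "restrict_space (borel :: (real \<times> real) measure) quadrant"
  have L: "fst \<in> Q \<Otimes>\<^sub>M pos_lborel \<rightarrow>\<^sub>M subprob_algebra ?R"
    by (rule measurable_compose[OF measurable_fst prior_measurable_subprob_algebra[OF _ assms]])
      (simp add: borel_open open_Times)
  have "(\<lambda>(p, s). (snd p, s)) \<in> (Q \<Otimes>\<^sub>M pos_lborel) \<Otimes>\<^sub>M ?R \<rightarrow>\<^sub>M pos_lborel \<Otimes>\<^sub>M ?R"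
    by measurable
  from measurable_compose[OF this inverse_gamma_kernel_measurable]
  have "(\<lambda>(p, s). ennreal (case s of (k, z) \<Rightarrow> inverse_gamma_kernel (snd p) k z)) \<in>
      borel_measurable ((Q \<Otimes>\<^sub>M pos_lborel) \<Otimes>\<^sub>M ?R)"
    by (simp add: case_prod_beta)
  from nn_integral_measurable_subprob_algebra2[OF this L] show ?thesis
    by (simp add: mixture_eq case_prod_beta')
qed

text \<open>
  Tonelli's theorem, since every kernel integrates to 1.
\<close>

lemma mixture_in_densities:
  assumes P: "P \<in> prob_measures quadrant"
  shows "mixture P \<in> densities"
proof -
  interpret P: prob_space P using prob_measuresD(1)[OF P] .
  interpret L: sigma_finite_measure pos_lborel
    by (rule sigma_finite_pos_lborel)
  interpret PL: pair_sigma_finite pos_lborel P ..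
  have meas: "(\<lambda>(x, s). ennreal (case s of (k, z) \<Rightarrow> inverse_gamma_kernel x k z)) \<in>
      borel_measurable (pos_lborel \<Otimes>\<^sub>M P)"
  proof -
    have "sets (pos_lborel \<Otimes>\<^sub>M P) = sets (pos_lborel \<Otimes>\<^sub>M restrict_space borel quadrant)"
      using prob_measuresD(2)[OF P] by (intro sets_pair_measure_cong) auto
    then show ?thesis
      using measurable_compose[OF inverse_gamma_kernel_measurable measurable_ennreal]
      by (simp add: case_prod_beta cong: measurable_cong_sets)
  qed
  have "mixture P \<in> borel_measurable pos_lborel"
    unfolding mixture_eq[abs_def] using P.borel_measurable_nn_integral[OF meas]
    by (simp add: case_prod_beta)
  moreover have "(\<integral>\<^sup>+x. mixture P x \<partial>pos_lborel) =
      (\<integral>\<^sup>+s. (\<integral>\<^sup>+x. ennreal (case s of (k, z) \<Rightarrow> inverse_gamma_kernel x k z) \<partial>pos_lborel) \<partial>P)"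
    unfolding mixture_eq using PL.Fubini[OF meas] by (simp add: case_prod_beta)
  moreover have "\<dots> = (\<integral>\<^sup>+s. 1 \<partial>P)"
    using prob_measuresD(3)[OF P] nn_integral_inverse_gamma_density
    by (intro nn_integral_cong) (auto simp: inverse_gamma_kernel_def)
  ultimately show ?thesis
    by (simp add: densities_def P.emeasure_space_1)
qed

lemma ereal_ln_measurable: "ereal_ln \<in> borel_measurable borel"
proof -
  have eq: "ereal_ln = (\<lambda>y. if y \<le> 0 then - \<infinity> else if y = \<infinity> then \<infinity> else ereal (ln (real_of_ereal y)))"
  proof
    fix y show "ereal_ln y =
        (if y \<le> 0 then - \<infinity> else if y = \<infinity> then \<infinity> else ereal (ln (real_of_ereal y)))"
      by (cases y) auto
  qed
  show ?thesis unfolding eq by measurable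
qed

text \<open>
  Without this the event that the divergence is small would not be an event of the induced prior,
  and its measure would be 0 by convention.
\<close>

lemma log_ratio_integral_mixture_measurable:
  assumes "is_prior quadrant Q" and f0[measurable]: "f0 \<in> borel_measurable pos_lborel"
  shows "(\<lambda>P. log_ratio_integral f0 (\<lambda>x. enn2ereal (mixture P x))) \<in> borel_measurable Q"
proof -
  interpret L: sigma_finite_measure pos_lborel
    by (rule sigma_finite_pos_lborel)
  note mixture_jointly_measurable[OF assms(1), measurable] ereal_ln_measurable[measurable]
  have "(\<lambda>(P, x). ereal (f0 x) * ereal_ln (ereal (f0 x) / enn2ereal (mixture P x))) \<in>
      borel_measurable (Q \<Otimes>\<^sub>M pos_lborel)"
    unfolding divide_ereal_def case_prod_beta by measurable
  note this[measurable]
  show ?thesis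
    unfolding log_ratio_integral_def ereal_integral_def
    by measurable
qed

text \<open>
  The sigma-algebra of the induced prior is the largest one that makes \<^const>\<open>mixture\<close>
  measurable, so its probabilities can be computed on the side of the mixing measures.
\<close>

lemma induced_prior:
  assumes "is_prior quadrant Q"
  shows space_induced_prior: "space (induced_prior Q) = densities"
    and emeasure_induced_prior: "A \<subseteq> densities \<Longrightarrow> mixture -` A \<inter> space Q \<in> sets Q \<Longrightarrow>
      emeasure (induced_prior Q) A = emeasure Q (mixture -` A \<inter> space Q)"
proof -
  let ?C = "{A. A \<subseteq> densities \<and> mixture -` A \<inter> space Q \<in> sets Q}"
  have C: "?C \<subseteq> Pow densities" by auto
  show "space (induced_prior Q) = densities"
    using C by (simp add: induced_prior_def space_measure_of)
  have "mixture \<in> Q \<rightarrow>\<^sub>M sigma densities ?C"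
    using assms mixture_in_densities by (intro measurable_measure_of C) (auto simp: is_prior_def)
  moreover assume "A \<subseteq> densities" "mixture -` A \<inter> space Q \<in> sets Q"
  ultimately show "emeasure (induced_prior Q) A = emeasure Q (mixture -` A \<inter> space Q)"
    unfolding induced_prior_def using C by (subst emeasure_distr) auto
qed

section \<open>Lower bounds on weak neighbourhoods\<close>

lemma bounded_image_compact_support:
  fixes f :: "'a::topological_space \<Rightarrow> 'b::real_normed_vector"
  assumes cont: "continuous_on S f" and L: "compact L" "L \<subseteq> S"
    and vanish: "\<And>s. s \<in> S - L \<Longrightarrow> f s = 0"
  shows "bounded (f ` S)"
proof (rule bounded_subset)
  show "bounded (insert 0 (f ` L))"
    using compact_continuous_image[OF continuous_on_subset[OF cont L(2)] L(1)]
    by (simp add: compact_imp_bounded)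
  show "f ` S \<subseteq> insert 0 (f ` L)"
    using vanish by auto
qed

text \<open>
  A weak neighbourhood controls finitely many integrals. Uniform continuity on the compact set
  \<open>C \<times> L\<close> makes the integrals of \<open>h x\<close>, as functions of \<open>x\<close>, equicontinuous in \<open>P\<close>, so a finite
  net of points \<open>x\<close> controls them on all of \<open>C\<close>.
\<close>

lemma weak_neighborhood_uniform_lower_bound:
  fixes h :: "'a::metric_space \<Rightarrow> 'b::metric_space \<Rightarrow> real"
  assumes C: "compact C" and L: "compact L" "L \<subseteq> S"
    and vanish: "\<And>x s. x \<in> C \<Longrightarrow> s \<in> S - L \<Longrightarrow> h x s = 0"
    and cont: "continuous_on (C \<times> S) (\<lambda>(x, s). h x s)"
    and P0: "P0 \<in> prob_measures S" and \<eta>: "\<eta> > 0"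
  obtains U where "openin (weak_topology S) U" "P0 \<in> U"
    "\<And>P. P \<in> U \<Longrightarrow> P \<in> prob_measures S"
    "\<And>P x. P \<in> U \<Longrightarrow> x \<in> C \<Longrightarrow> (\<integral>s. h x s \<partial>P) > (\<integral>s. h x s \<partial>P0) - \<eta>"
proof -
  have "uniformly_continuous_on (C \<times> L) (\<lambda>(x, s). h x s)"
    using C L cont
    by (intro compact_uniformly_continuous compact_Times) (auto intro: continuous_on_subset)
  moreover have "\<eta> / 4 > 0" using \<eta> by simp
  ultimately obtain r where r0: "r > 0" "\<And>p p'. p \<in> C \<times> L \<Longrightarrow> p' \<in> C \<times> L \<Longrightarrow> dist p' p < r \<Longrightarrow>
      dist (case p' of (x, s) \<Rightarrow> h x s) (case p of (x, s) \<Rightarrow> h x s) < \<eta> / 4"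
    unfolding uniformly_continuous_on_def by meson
  have r: "r > 0" "\<And>x s x' s'. x \<in> C \<Longrightarrow> s \<in> L \<Longrightarrow> x' \<in> C \<Longrightarrow> s' \<in> L \<Longrightarrow>
      dist (x', s') (x, s) < r \<Longrightarrow> dist (h x' s') (h x s) < \<eta> / 4"
    using r0(1) r0(2)[of "(_, _)" "(_, _)"] by auto
  obtain T where T: "T \<subseteq> C" "finite T" "C \<subseteq> (\<Union>x\<in>T. ball x r)"
  proof (rule compactE_image[OF C, of C "\<lambda>x. ball x r"])
    show "C \<subseteq> (\<Union>x\<in>C. ball x r)" using r(1) by auto
  qed auto
  have hc: "continuous_on S (h x)" if "x \<in> C" for x
    using continuous_on_compose2[OF cont, of S "\<lambda>s. (x, s)"] that
    by (auto simp: continuous_on_Pair)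
  have hb: "bounded (h x ` S)" if "x \<in> C" for x
    using bounded_image_compact_support[OF hc[OF that] L] vanish[OF that] by simp
  define W where "W = (\<lambda>x. {P \<in> prob_measures S. (\<integral>s. h x s \<partial>P) \<in> {(\<integral>s. h x s \<partial>P0) - \<eta> / 2<..}})"
  \<comment> \<open>\<open>V\<close> is the whole space; it keeps the intersection below nonempty if \<open>C\<close> is empty.\<close>
  define V where "V = {P \<in> prob_measures S. (\<integral>s. 0 \<partial>P) \<in> (UNIV :: real set)}"
  show thesis
  proof
    show "openin (weak_topology S) (\<Inter>(insert V (W ` T)))"
    proof (rule openin_Inter)
      fix X assume "X \<in> insert V (W ` T)"
      moreover have "openin (weak_topology S) V"
        unfolding V_def by (rule openin_weak_topology_integral) (auto simp: bounded_iff)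
      moreover have "openin (weak_topology S) (W x)" if "x \<in> T" for x
        unfolding W_def using T(1) that by (intro openin_weak_topology_integral hc hb) auto
      ultimately show "openin (weak_topology S) X" by auto
    qed (use T in auto)
    show "P0 \<in> \<Inter>(insert V (W ` T))"
      using P0 \<eta> by (auto simp: V_def W_def)
    fix P assume P: "P \<in> \<Inter>(insert V (W ` T))"
    then show PS: "P \<in> prob_measures S" by (simp add: V_def)
    fix x assume x: "x \<in> C"
    then obtain y where y: "y \<in> T" "dist y x < r" using T(3) by auto
    have yC: "y \<in> C" using y T by auto
    have step: "(\<integral>s. h u s \<partial>R) - \<eta> / 4 \<le> (\<integral>s. h v s \<partial>R)"
      if "u \<in> C" "v \<in> C" "dist u v < r" "R \<in> prob_measures S" for u v R
    proof -
      interpret R: prob_space R using prob_measuresD(1)[OF that(4)] .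
      have "(\<integral>s. h u s \<partial>R) - \<eta> / 4 = (\<integral>s. h u s - \<eta> / 4 \<partial>R)"
        using integrable_prob_measures[OF that(4) hc[OF that(1)] hb[OF that(1)]]
        by (simp add: R.prob_space)
      also have "\<dots> \<le> (\<integral>s. h v s \<partial>R)"
      proof (rule integral_mono)
        show "integrable R (\<lambda>s. h u s - \<eta> / 4)" "integrable R (h v)"
          using integrable_prob_measures[OF that(4) hc hb] that by auto
        fix s assume "s \<in> space R"
        then have "s \<in> S" using prob_measuresD(3)[OF that(4)] by simp
        show "h u s - \<eta> / 4 \<le> h v s"
        proof (cases "s \<in> L")
          case True
          then have "dist (h u s) (h v s) < \<eta> / 4"
            using that by (intro r(2)) (auto simp: dist_Pair_Pair)
          then show ?thesis unfolding dist_real_def by linarith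
        next
          case False
          then show ?thesis using vanish[of u s] vanish[of v s] that \<open>s \<in> S\<close> \<eta> by auto
        qed
      qed
      finally show ?thesis .
    qed
    have "(\<integral>s. h y s \<partial>P) > (\<integral>s. h y s \<partial>P0) - \<eta> / 2"
      using P y by (auto simp: W_def)
    moreover have "(\<integral>s. h y s \<partial>P) - \<eta> / 4 \<le> (\<integral>s. h x s \<partial>P)"
      using step[OF yC x y(2) PS] .
    moreover have "(\<integral>s. h x s \<partial>P0) - \<eta> / 4 \<le> (\<integral>s. h y s \<partial>P0)"
      using step[OF x yC _ P0] y(2) by (simp add: dist_commute)
    ultimately show "(\<integral>s. h x s \<partial>P) > (\<integral>s. h x s \<partial>P0) - \<eta>"
      by linarith
  qed
qed

lemma weighted_kernel_le_mixture:
  assumes P: "P \<in> prob_measures quadrant" and x: "x > 0"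
    and \<tau>: "\<And>s. s \<in> quadrant \<Longrightarrow> 0 \<le> \<tau> s" "\<And>s. s \<in> quadrant \<Longrightarrow> \<tau> s \<le> 1"
  shows "ennreal (\<integral>s. \<tau> s * inverse_gamma_kernel x (fst s) (snd s) \<partial>P) \<le> mixture P x"
proof (cases "integrable P (\<lambda>s. \<tau> s * inverse_gamma_kernel x (fst s) (snd s))")
  case True
  have pos: "0 \<le> inverse_gamma_kernel x (fst s) (snd s)" if "s \<in> space P" for s
    using that prob_measuresD(3)[OF P] by (simp add: inverse_gamma_kernel_nonneg mem_Times_iff)
  have "ennreal (\<integral>s. \<tau> s * inverse_gamma_kernel x (fst s) (snd s) \<partial>P) =
      (\<integral>\<^sup>+s. ennreal (\<tau> s * inverse_gamma_kernel x (fst s) (snd s)) \<partial>P)"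
    using \<tau> pos prob_measuresD(3)[OF P] by (intro nn_integral_eq_integral[symmetric] True AE_I2) auto
  also have "\<dots> \<le> mixture P x"
    unfolding mixture_eq using \<tau> pos prob_measuresD(3)[OF P]
    by (intro nn_integral_mono ennreal_leI mult_left_le_one_le) auto
  finally show ?thesis .
qed (simp add: not_integrable_integral_eq)

lemma abs_ln_le:
  fixes x :: real
  assumes "x > 0"
  shows "\<bar>ln x\<bar> \<le> x + 1 / x"
proof -
  have "1 / x > 0" using assms by simp
  moreover have "- ln x \<le> 1 / x - 1"
    using assms ln_le_minus_one[of "1 / x"] by (simp add: ln_div)
  ultimately show ?thesis
    using assms ln_le_minus_one[of x] unfolding abs_le_iff by linarith
qed

text \<open>
  On the square \<open>[1, 2]\<^sup>2\<close> the exponents satisfy \<open>k + 1 \<le> 3\<close> and \<open>k z \<le> 4\<close>, and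
  \<open>\<bar>ln x\<bar> \<le> x + 1 / x\<close>, so minus the logarithm of the kernel is at most a constant plus
  \<open>3 (x + 1 / x) + 4 / x\<close>.
\<close>

lemma inverse_gamma_kernel_lower_bound:
  obtains G where "G > 0"
    "\<And>x k z. x > 0 \<Longrightarrow> k \<in> {1..2} \<Longrightarrow> z \<in> {1..2} \<Longrightarrow>
       exp (- (3 * x + 7 / x)) / G \<le> inverse_gamma_kernel x k z"
proof -
  have "continuous_on {1..2::real} Gamma"
    by (intro continuous_on_Gamma) (auto elim!: nonpos_Ints_cases)
  from continuous_attains_sup[OF _ _ this]
  obtain k0 where k0: "k0 \<in> {1..2::real}" "\<And>k. k \<in> {1..2} \<Longrightarrow> Gamma k \<le> Gamma k0" by auto
  show thesis
  proof
    show "Gamma k0 > 0" using k0 by (intro Gamma_real_pos) auto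
    fix x k z :: real assume x: "x > 0" and k: "k \<in> {1..2}" and z: "z \<in> {1..2}"
    have kz: "1 \<le> k * z" using mult_mono[of 1 k 1 z] k z by auto
    have kz4: "k * z \<le> 4" using mult_mono[of k 2 z 2] k z by auto
    have "(k + 1) * ln x \<le> (k + 1) * \<bar>ln x\<bar>"
      using k by (intro mult_left_mono) auto
    also have "\<dots> \<le> 3 * (x + 1 / x)"
      using k abs_ln_le[OF x] by (intro mult_mono) auto
    finally have "(k + 1) * ln x \<le> 3 * (x + 1 / x)" .
    moreover have "k * z / x \<le> 4 / x" using x kz4 by (simp add: divide_right_mono)
    ultimately have "exp (- (3 * x + 7 / x)) \<le> exp ((- k - 1) * ln x + - (k * z) / x)"
      by (simp add: algebra_simps add_divide_distrib)
    also have "\<dots> = x powr (- k - 1) * exp (- (k * z) / x)"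
      using x by (subst exp_add) (simp add: powr_def)
    finally have 1: "exp (- (3 * x + 7 / x)) \<le> x powr (- k - 1) * exp (- (k * z) / x)" .
    have "1 / Gamma k0 \<le> (k * z) powr k / Gamma k"
      using k0(2)[OF k] k kz by (intro frac_le) (auto intro: ge_one_powr_ge_zero Gamma_real_pos)
    then have "(1 / Gamma k0) * exp (- (3 * x + 7 / x)) \<le>
        (k * z) powr k / Gamma k * (x powr (- k - 1) * exp (- (k * z) / x))"
      using 1 k by (intro mult_mono) (auto intro: divide_nonneg_pos Gamma_real_pos)
    then show "exp (- (3 * x + 7 / x)) / Gamma k0 \<le> inverse_gamma_kernel x k z"
      by (simp add: inverse_gamma_kernel_eq mult.assoc)
  qed
qed

text \<open>
  A continuous function with values in \<open>[0, 1]\<close>, supported in \<open>[1, 2]\<^sup>2\<close> and equal to 1 at the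
  centre of that square.
\<close>

definition bump :: "real \<times> real \<Rightarrow> real" where
  "bump s = max 0 (1 - 2 * \<bar>fst s - 3 / 2\<bar>) * max 0 (1 - 2 * \<bar>snd s - 3 / 2\<bar>)"

text \<open>
  A continuous function with values in \<open>[0, 1]\<close> and, for \<open>n > 0\<close>, compact support in the open
  quadrant. On the line \<open>k = n\<close> it equals 1 for \<open>2 / n \<le> z \<le> n\<close>.
\<close>

definition cutoff :: "nat \<Rightarrow> real \<times> real \<Rightarrow> real" where
  "cutoff n s = max 0 (1 - 2 * \<bar>fst s - n\<bar>) * max 0 (min 1 (min (n * snd s - 1) (n + 1 - snd s)))"

lemma bump_bounds: "0 \<le> bump s" "bump s \<le> 1"
  by (auto simp: bump_def intro!: mult_nonneg_nonneg mult_le_one)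

lemma cutoff_bounds: "0 \<le> cutoff n s" "cutoff n s \<le> 1"
  by (auto simp: cutoff_def intro!: mult_nonneg_nonneg mult_le_one)

lemma continuous_on_cutoff_kernel:
  "continuous_on ({0<..} \<times> quadrant) (\<lambda>(x, s). cutoff n s * inverse_gamma_kernel x (fst s) (snd s))"
  unfolding cutoff_def case_prod_beta
  using continuous_on_inverse_gamma_kernel[unfolded case_prod_beta]
  by (intro continuous_intros) auto

lemma bump_continuous_bounded: "continuous_on S bump" "bounded (bump ` S)"
proof -
  show "continuous_on S bump"
    unfolding bump_def[abs_def] by (intro continuous_intros)
  show "bounded (bump ` S)"
    using bump_bounds by (auto simp: bounded_iff intro!: exI[of _ 1])
qed

lemma cutoff_eq_0:
  assumes "n > 0" "s \<notin> {real n - 1 / 2..real n + 1 / 2} \<times> {1 / real n..real n + 1}"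
  shows "cutoff n s = 0"
  using assms by (auto simp: cutoff_def mem_Times_iff abs_if field_simps max_def min_def)

lemma cutoff_support_subset_quadrant:
  "n > 0 \<Longrightarrow> {real n - 1 / 2..real n + 1 / 2} \<times> {1 / real n..real n + 1} \<subseteq> quadrant"
  by (auto intro: less_le_trans[of 0 "1 / real n"])

lemma cutoff_kernel_continuous_bounded:
  assumes "n > 0" "x > 0"
  shows "continuous_on quadrant (\<lambda>s. cutoff n s * inverse_gamma_kernel x (fst s) (snd s))"
    and "bounded ((\<lambda>s. cutoff n s * inverse_gamma_kernel x (fst s) (snd s)) ` quadrant)"
proof -
  show cont: "continuous_on quadrant (\<lambda>s. cutoff n s * inverse_gamma_kernel x (fst s) (snd s))"
    using continuous_on_compose2[OF continuous_on_cutoff_kernel, of quadrant "\<lambda>s. (x, s)" n] assms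
    by (auto simp: continuous_on_Pair)
  show "bounded ((\<lambda>s. cutoff n s * inverse_gamma_kernel x (fst s) (snd s)) ` quadrant)"
  proof (rule bounded_image_compact_support[OF cont])
    show "compact ({real n - 1 / 2..real n + 1 / 2} \<times> {1 / real n..real n + 1})"
      by (intro compact_Times) auto
  qed (use assms cutoff_support_subset_quadrant cutoff_eq_0 in auto)
qed

text \<open>
  Two lower bounds for the mixture survive in a weak neighbourhood of \<open>P0\<close>. The mass near the
  centre of \<open>[1, 2]\<^sup>2\<close> gives a bound of known decay at every \<open>x\<close>; on a compact interval the
  truncated mixture of \<open>P0\<close> is itself a bound, up to \<open>\<eta>\<close>.
\<close>

lemma weak_neighborhood_mixture_lower_bound:
  fixes b G \<eta> :: real and n :: nat
  assumes P0: "P0 \<in> prob_measures quadrant" and n: "n > 0" and \<eta>: "\<eta> > 0" and b: "(\<integral>s. bump s \<partial>P0) > b"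
    and G: "G > 0" "\<And>x k z. x > 0 \<Longrightarrow> k \<in> {1..2} \<Longrightarrow> z \<in> {1..2} \<Longrightarrow>
       exp (- (3 * x + 7 / x)) / G \<le> inverse_gamma_kernel x k z"
  obtains U where "openin (weak_topology quadrant) U" "P0 \<in> U"
    "\<And>P. P \<in> U \<Longrightarrow> P \<in> prob_measures quadrant"
    "\<And>P x. P \<in> U \<Longrightarrow> x > 0 \<Longrightarrow> ennreal (b * (exp (- (3 * x + 7 / x)) / G)) \<le> mixture P x"
    "\<And>P x. P \<in> U \<Longrightarrow> x \<in> {1 / real n..real n} \<Longrightarrow>
       ennreal ((\<integral>s. cutoff n s * inverse_gamma_kernel x (fst s) (snd s) \<partial>P0) - \<eta>) \<le> mixture P x"
proof -
  define V where "V = {P \<in> prob_measures quadrant. (\<integral>s. bump s \<partial>P) \<in> {b<..}}"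
  have V: "openin (weak_topology quadrant) V"
    unfolding V_def by (intro openin_weak_topology_integral bump_continuous_bounded) auto
  let ?C = "{1 / real n..real n}"
  let ?L = "{real n - 1 / 2..real n + 1 / 2} \<times> {1 / real n..real n + 1}"
  have C0: "?C \<subseteq> {0<..}"
    using n by (auto intro: less_le_trans[of 0 "1 / real n"])
  note L0 = cutoff_support_subset_quadrant[OF n]
  have vanish: "cutoff n s * inverse_gamma_kernel x (fst s) (snd s) = 0"
    if "s \<in> quadrant - ?L" for x s
    using that cutoff_eq_0[OF n, of s] by simp
  have "continuous_on (?C \<times> quadrant) (\<lambda>(x, s). cutoff n s * inverse_gamma_kernel x (fst s) (snd s))"
    by (rule continuous_on_subset[OF continuous_on_cutoff_kernel]) (use C0 in auto)
  from weak_neighborhood_uniform_lower_bound[OF _ _ L0 vanish this P0 \<eta>]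
  obtain W where W: "openin (weak_topology quadrant) W" "P0 \<in> W"
    "\<And>P. P \<in> W \<Longrightarrow> P \<in> prob_measures quadrant"
    "\<And>P x. P \<in> W \<Longrightarrow> x \<in> ?C \<Longrightarrow>
       (\<integral>s. cutoff n s * inverse_gamma_kernel x (fst s) (snd s) \<partial>P) >
       (\<integral>s. cutoff n s * inverse_gamma_kernel x (fst s) (snd s) \<partial>P0) - \<eta>"
    by (auto simp: compact_Times)
  show thesis
  proof
    show "openin (weak_topology quadrant) (V \<inter> W)" using V W(1) by (rule openin_Int)
    show "P0 \<in> V \<inter> W" using P0 b W(2) by (simp add: V_def)
    fix P assume P: "P \<in> V \<inter> W"
    then show PS: "P \<in> prob_measures quadrant" using W(3) by auto
    show "ennreal (b * (exp (- (3 * x + 7 / x)) / G)) \<le> mixture P x" if x: "x > 0" for x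
    proof -
      let ?w = "exp (- (3 * x + 7 / x)) / G"
      have w: "?w > 0" using G(1) by simp
      have "b * ?w \<le> (\<integral>s. bump s \<partial>P) * ?w"
        using P w by (intro mult_right_mono) (auto simp: V_def)
      then have "ennreal (b * ?w) \<le> ennreal (\<integral>s. bump s * ?w \<partial>P)"
        by (simp add: ennreal_leI)
      also have "\<dots> = (\<integral>\<^sup>+s. ennreal (bump s * ?w) \<partial>P)"
        using integrable_prob_measures[OF PS bump_continuous_bounded] bump_bounds w
        by (intro nn_integral_eq_integral[symmetric] integrable_mult_left AE_I2 mult_nonneg_nonneg) auto
      also have "\<dots> \<le> mixture P x"
        unfolding mixture_eq
      proof (intro nn_integral_mono ennreal_leI)
        fix s assume "s \<in> space P"
        then have s: "s \<in> quadrant" using prob_measuresD(3)[OF PS] by simp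
        show "bump s * ?w \<le> inverse_gamma_kernel x (fst s) (snd s)"
        proof (cases "fst s \<in> {1..2} \<and> snd s \<in> {1..2}")
          case True
          then have "1 * ?w \<le> inverse_gamma_kernel x (fst s) (snd s)"
            using G(2)[OF x] by simp
          moreover have "bump s * ?w \<le> 1 * ?w"
            using w bump_bounds by (intro mult_right_mono) auto
          ultimately show ?thesis by linarith
        next
          case False
          then have "bump s = 0" by (auto simp: bump_def abs_if max_def)
          then show ?thesis using s by (simp add: inverse_gamma_kernel_nonneg mem_Times_iff)
        qed
      qed
      finally show ?thesis .
    qed
    fix x assume x: "x \<in> ?C"
    then have "ennreal ((\<integral>s. cutoff n s * inverse_gamma_kernel x (fst s) (snd s) \<partial>P0) - \<eta>) \<le>
        ennreal (\<integral>s. cutoff n s * inverse_gamma_kernel x (fst s) (snd s) \<partial>P)"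
      using P W(4)[of P x] by (auto intro: ennreal_leI)
    also have "\<dots> \<le> mixture P x"
      using x C0 cutoff_bounds by (intro weighted_kernel_le_mixture PS) auto
    finally show "ennreal ((\<integral>s. cutoff n s * inverse_gamma_kernel x (fst s) (snd s) \<partial>P0) - \<eta>) \<le>
        mixture P x" .
  qed
qed

section \<open>Mixing measures with an atom\<close>

text \<open>
  A convex combination is the law of a random choice: an independent coin decides between \<open>s\<close>
  and a point drawn from \<open>P\<close>.
\<close>

lemma prob_measure_add_atom:
  assumes S: "S \<in> sets borel" and P: "P \<in> prob_measures S" and s: "s \<in> S" and \<alpha>: "0 \<le> \<alpha>" "\<alpha> \<le> 1"
  obtains P' where "P' \<in> prob_measures S"
    "\<And>g. g \<in> borel_measurable (restrict_space borel S) \<Longrightarrow>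
       (\<integral>\<^sup>+t. g t \<partial>P') = ennreal \<alpha> * g s + ennreal (1 - \<alpha>) * (\<integral>\<^sup>+t. g t \<partial>P)"
proof -
  interpret P: prob_space P using prob_measuresD(1)[OF P] .
  let ?B = "measure_pmf (bernoulli_pmf \<alpha>)"
  interpret B: prob_space ?B by (rule prob_space_measure_pmf)
  interpret PB: pair_prob_space P ?B ..
  let ?R = "restrict_space borel S"
  let ?T = "\<lambda>(t, b). if b then s else t"
  have PR [measurable_cong]: "sets P = sets ?R" using prob_measuresD(2)[OF P] .
  have T: "?T \<in> P \<Otimes>\<^sub>M ?B \<rightarrow>\<^sub>M ?R"
  proof -
    have "s \<in> space ?R" using s by (simp add: space_restrict_space)
    moreover have "fst \<in> P \<Otimes>\<^sub>M ?B \<rightarrow>\<^sub>M ?R"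
      using measurable_fst[of P ?B] PR by (simp cong: measurable_cong_sets)
    moreover have "Measurable.pred (P \<Otimes>\<^sub>M ?B) snd"
      by (rule measurable_compose[OF measurable_snd]) simp
    ultimately show ?thesis
      unfolding case_prod_beta by (intro measurable_If) auto
  qed
  show thesis
  proof
    show "distr (P \<Otimes>\<^sub>M ?B) ?R ?T \<in> prob_measures S"
      using PB.prob_space_distr[OF T] by (simp add: prob_measures_def)
    fix g :: "'a \<Rightarrow> ennreal" assume g [measurable]: "g \<in> borel_measurable ?R"
    have "(\<integral>\<^sup>+t. g t \<partial>distr (P \<Otimes>\<^sub>M ?B) ?R ?T) = (\<integral>\<^sup>+p. g (?T p) \<partial>(P \<Otimes>\<^sub>M ?B))"
      by (rule nn_integral_distr[OF T]) simp
    also have "\<dots> = (\<integral>\<^sup>+t. \<integral>\<^sup>+b. g (?T (t, b)) \<partial>?B \<partial>P)"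
      using measurable_compose[OF T g] by (intro measure_pmf.nn_integral_fst[symmetric]) simp
    also have "\<dots> = (\<integral>\<^sup>+t. g s * ennreal \<alpha> + g t * ennreal (1 - \<alpha>) \<partial>P)"
      using \<alpha> by simp
    also have "\<dots> = ennreal \<alpha> * g s + ennreal (1 - \<alpha>) * (\<integral>\<^sup>+t. g t \<partial>P)"
      by (simp add: nn_integral_add nn_integral_multc P.emeasure_space_1 mult.commute)
    finally show "(\<integral>\<^sup>+t. g t \<partial>distr (P \<Otimes>\<^sub>M ?B) ?R ?T) =
        ennreal \<alpha> * g s + ennreal (1 - \<alpha>) * (\<integral>\<^sup>+t. g t \<partial>P)" .
  qed
qed

lemma atom_plus_line_measure:
  fixes f :: "real \<Rightarrow> real" and k :: real
  assumes f [measurable]: "f \<in> borel_measurable pos_lborel"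
    and density: "(\<integral>\<^sup>+x. ennreal (f x) \<partial>pos_lborel) = 1"
    and k: "k > 0" and s: "s \<in> quadrant" and \<alpha>: "0 \<le> \<alpha>" "\<alpha> \<le> 1"
  obtains P where "P \<in> prob_measures quadrant"
    "\<And>g. g \<in> borel_measurable (restrict_space borel quadrant) \<Longrightarrow>
       (\<integral>\<^sup>+t. g t \<partial>P) = ennreal \<alpha> * g s + ennreal (1 - \<alpha>) * (\<integral>\<^sup>+z. ennreal (f z) * g (k, z) \<partial>pos_lborel)"
proof -
  let ?R = "restrict_space (borel :: (real \<times> real) measure) quadrant"
  let ?N = "density pos_lborel (\<lambda>x. ennreal (f x))"
  have N: "prob_space ?N"
  proof (rule prob_spaceI)
    have "emeasure ?N (space pos_lborel) =
        (\<integral>\<^sup>+x. ennreal (f x) * indicator (space pos_lborel) x \<partial>pos_lborel)"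
      by (intro emeasure_density sets.top) simp
    also have "\<dots> = (\<integral>\<^sup>+x. ennreal (f x) \<partial>pos_lborel)"
      by (rule nn_integral_cong) simp
    finally show "emeasure ?N (space ?N) = 1" using density by simp
  qed
  have T: "Pair k \<in> pos_lborel \<rightarrow>\<^sub>M ?R"
    using k by (intro measurable_restrict_space2 borel_measurable_Pair)
      (auto simp: space_restrict_space measurable_restrict_space1)
  have P1: "distr ?N ?R (Pair k) \<in> prob_measures quadrant"
    using prob_space.prob_space_distr[OF N, of "Pair k" ?R] T by (simp add: prob_measures_def)
  have quadrant: "quadrant \<in> sets borel"
    by (simp add: borel_open open_Times)
  from prob_measure_add_atom[OF quadrant P1 s \<alpha>] obtain P where P: "P \<in> prob_measures quadrant"
    "\<And>g. g \<in> borel_measurable ?R \<Longrightarrow> (\<integral>\<^sup>+t. g t \<partial>P) =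
       ennreal \<alpha> * g s + ennreal (1 - \<alpha>) * (\<integral>\<^sup>+t. g t \<partial>distr ?N ?R (Pair k))" by blast
  show thesis
  proof
    fix g :: "real \<times> real \<Rightarrow> ennreal" assume g: "g \<in> borel_measurable ?R"
    have "(\<integral>\<^sup>+t. g t \<partial>distr ?N ?R (Pair k)) = (\<integral>\<^sup>+z. ennreal (f z) * g (k, z) \<partial>pos_lborel)"
      using T g measurable_compose[OF T g]
      by (subst nn_integral_distr) (simp_all add: nn_integral_density)
    with P(2)[OF g] show "(\<integral>\<^sup>+t. g t \<partial>P) =
        ennreal \<alpha> * g s + ennreal (1 - \<alpha>) * (\<integral>\<^sup>+z. ennreal (f z) * g (k, z) \<partial>pos_lborel)" by simp
  qed (rule P)
qed

section \<open>Concentration of the kernel\<close>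

text \<open>
  In \<open>z\<close> the kernel is a probability density whose mean square deviation from \<open>x\<close> tends to 0, so by
  Chebyshev's inequality its mass concentrates in any neighbourhood of \<open>x\<close>. On a small one \<open>f\<close>
  is almost \<open>f x\<close>, and the cutoff is eventually 1 there.
\<close>

lemma inverse_gamma_kernel_smoothing_limit:
  assumes cont: "continuous_on {0<..} f" and nonneg: "\<And>z. z > 0 \<Longrightarrow> f z \<ge> 0"
    and x: "x > 0" and \<theta>: "\<theta> > 0"
  shows "eventually (\<lambda>n. ennreal (f x - \<theta>) \<le>
     (\<integral>\<^sup>+z. ennreal (cutoff n (real n, z) * inverse_gamma_kernel x n z * f z) \<partial>pos_lborel)) sequentially"
proof (cases "f x - \<theta> > 0")
  case True
  define c where "c = f x - \<theta> / 2"
  have c: "c > 0" "f x - \<theta> < c" using True \<theta> by (auto simp: c_def)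
  have "isCont f x"
    using cont x by (simp add: continuous_on_eq_continuous_at)
  then obtain \<delta>' where \<delta>': "\<delta>' > 0" "\<And>z. dist z x < \<delta>' \<Longrightarrow> dist (f z) (f x) < \<theta> / 2"
    using \<theta> unfolding continuous_at_eps_delta dist_real_def by (meson half_gt_zero)
  define \<delta> where "\<delta> = min \<delta>' (x / 2)"
  have \<delta>: "\<delta> > 0" using \<delta>' x by (simp add: \<delta>_def)
  \<comment> \<open>The restriction to \<open>(x / 2, 2 x)\<close> keeps the neighbourhood where the cutoff is eventually 1.\<close>
  have near: "c \<le> f z \<and> x / 2 < z \<and> z < 2 * x" if "\<bar>z - x\<bar> < \<delta>" for z
  proof -
    have "\<bar>z - x\<bar> < \<delta>'" "\<bar>z - x\<bar> < x / 2" using that by (auto simp: \<delta>_def)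
    moreover from this have "\<bar>f z - f x\<bar> < \<theta> / 2" using \<delta>'(2)[of z] by (simp add: dist_real_def)
    ultimately show ?thesis unfolding c_def by linarith
  qed
  define v where "v = (\<lambda>n::nat. x\<^sup>2 * (real n + 2) / (real n)\<^sup>2 / \<delta>\<^sup>2)"
  have "v \<longlonglongrightarrow> 0"
    unfolding v_def using x \<delta> by real_asymp
  then have "(\<lambda>n. c * (1 - v n)) \<longlonglongrightarrow> c * (1 - 0)"
    by (intro tendsto_intros)
  then have "eventually (\<lambda>n. f x - \<theta> < c * (1 - v n)) sequentially"
    using c by (intro order_tendstoD) auto
  moreover have "eventually (\<lambda>n. real n \<ge> max 1 (max (4 / x) (2 * x))) sequentially"
    by real_asymp
  ultimately show ?thesis
  proof eventually_elim
    case (elim n)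
    then have n: "n > 0" "4 / x \<le> real n" "2 * x \<le> real n" by auto
    let ?e = "erlang_density n (real n / x)"
    have e: "?e z \<ge> 0" for z using n x by (intro erlang_density_nonneg) auto
    define A where "A = (\<integral>\<^sup>+z. ennreal (?e z * indicator {z. \<bar>z - x\<bar> < \<delta>} z) \<partial>lborel)"
    \<comment> \<open>Chebyshev's inequality: off the neighbourhood \<open>1 \<le> (z - x)\<^sup>2 / \<delta>\<^sup>2\<close>.\<close>
    have "1 = (\<integral>\<^sup>+z. ennreal (?e z) \<partial>lborel)"
      using nn_integral_erlang_ith_moment[of "real n / x" n 0] n x by simp
    also have "\<dots> \<le> (\<integral>\<^sup>+z. ennreal (?e z * indicator {z. \<bar>z - x\<bar> < \<delta>} z) +
        ennreal (?e z * (z - x)\<^sup>2) * ennreal (1 / \<delta>\<^sup>2) \<partial>lborel)"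
    proof (rule nn_integral_mono)
      fix z
      have "?e z \<le> ?e z * indicator {z. \<bar>z - x\<bar> < \<delta>} z + ?e z * (z - x)\<^sup>2 * (1 / \<delta>\<^sup>2)"
      proof (cases "\<bar>z - x\<bar> < \<delta>")
        case False
        then have "\<delta>\<^sup>2 \<le> (z - x)\<^sup>2" using \<delta> by (metis abs_le_square_iff abs_of_pos not_less)
        then have "?e z * 1 \<le> ?e z * ((z - x)\<^sup>2 / \<delta>\<^sup>2)"
          using \<delta> e by (intro mult_left_mono) auto
        then show ?thesis using False by simp
      qed (use e in auto)
      then show "ennreal (?e z) \<le> ennreal (?e z * indicator {z. \<bar>z - x\<bar> < \<delta>} z) +
          ennreal (?e z * (z - x)\<^sup>2) * ennreal (1 / \<delta>\<^sup>2)"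
        using e by (simp flip: ennreal_plus ennreal_mult add: ennreal_leI)
    qed
    also have "\<dots> = A + (\<integral>\<^sup>+z. ennreal (?e z * (z - x)\<^sup>2) \<partial>lborel) * ennreal (1 / \<delta>\<^sup>2)"
      unfolding A_def by (subst nn_integral_add) (auto simp: nn_integral_multc)
    also have "\<dots> = A + ennreal (v n)"
      unfolding nn_integral_erlang_density_square_deviation[OF x n(1)] v_def
      by (simp flip: ennreal_mult)
    finally have A: "ennreal (1 - v n) \<le> A"
      by (cases A) (auto simp: v_def simp flip: ennreal_plus)
    have "ennreal (f x - \<theta>) \<le> ennreal c * ennreal (1 - v n)"
      using elim c by (simp add: ennreal_leI flip: ennreal_mult')
    also have "\<dots> \<le> ennreal c * A"
      using A by (rule mult_left_mono) simp
    also have "\<dots> = (\<integral>\<^sup>+z. ennreal c * ennreal (?e z * indicator {z. \<bar>z - x\<bar> < \<delta>} z) \<partial>lborel)"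
      unfolding A_def by (subst nn_integral_cmult) auto
    also have "\<dots> \<le> (\<integral>\<^sup>+z. ennreal (cutoff n (real n, z) * inverse_gamma_kernel x n z * f z) *
        indicator {0<..} z \<partial>lborel)"
    proof (rule nn_integral_mono)
      fix z
      show "ennreal c * ennreal (?e z * indicator {z. \<bar>z - x\<bar> < \<delta>} z) \<le>
        ennreal (cutoff n (real n, z) * inverse_gamma_kernel x n z * f z) * indicator {0<..} z"
      proof (cases "\<bar>z - x\<bar> < \<delta>")
        case True
        note nz = near[OF True]
        then have z: "z > 0" using x by linarith
        have "2 \<le> real n * (x / 2)" using n x by (simp add: field_simps)
        also have "\<dots> \<le> real n * z" using nz by (intro mult_left_mono) auto
        finally have "cutoff n (real n, z) = 1" using nz n by (auto simp: cutoff_def)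
        moreover have "c * ?e z \<le> ?e z * f z"
          using nz e[of z] by (subst mult.commute) (simp add: mult_left_mono)
        ultimately show ?thesis
          using True z c e[of z] x n
          by (simp add: inverse_gamma_kernel_eq_erlang_density ennreal_leI flip: ennreal_mult)
      qed simp
    qed
    finally show ?case
      by (simp add: nn_integral_restrict_space)
  qed
qed (simp add: ennreal_neg)

section \<open>Control of the divergence\<close>

text \<open>
  The divergence is at most its positive part, which is antitone in the second density. A
  finite positive part also rules out the undefined case \<open>\<infinity> - \<infinity>\<close>.
\<close>

lemma log_ratio_integral_less:
  assumes p: "\<And>x. x > 0 \<Longrightarrow> p x > 0" and q: "\<And>x. x > 0 \<Longrightarrow> q x > 0"
    and le: "\<And>x. x > 0 \<Longrightarrow> ennreal (q x) \<le> f x"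
    and int: "(\<integral>\<^sup>+x. ennreal (p x * max 0 (ln (p x / q x))) \<partial>pos_lborel) < ennreal \<epsilon>"
  shows "log_ratio_integral p (\<lambda>x. enn2ereal (f x)) < ereal \<epsilon>"
proof -
  let ?g = "\<lambda>x. ereal (p x) * ereal_ln (ereal (p x) / enn2ereal (f x))"
  have "e2ennreal (?g x) \<le> ennreal (p x * max 0 (ln (p x / q x)))" if "x > 0" for x
  proof (cases "f x")
    case (real r)
    then have r: "q x \<le> r" "r > 0"
      using le[OF that] q[OF that] by (auto simp: ennreal_le_iff2)
    have "p x * ln (p x / r) \<le> p x * max 0 (ln (p x / q x))"
      using p[OF that] q[OF that] r
      by (intro mult_left_mono) (auto intro!: max.coboundedI2 ln_mono divide_left_mono)
    then show ?thesis
      using real r p[OF that] by (simp add: divide_le_0_iff e2ennreal_ereal ennreal_leI)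
  next
    case top
    then show ?thesis
      using p[OF that] ereal_ln.simps(1)[of 0] by (simp add: e2ennreal_neg zero_ereal_def)
  qed
  then have "(\<integral>\<^sup>+x. e2ennreal (?g x) \<partial>pos_lborel) \<le>
      (\<integral>\<^sup>+x. ennreal (p x * max 0 (ln (p x / q x))) \<partial>pos_lborel)"
    by (intro nn_integral_mono) (simp add: space_restrict_space)
  with int have "(\<integral>\<^sup>+x. e2ennreal (?g x) \<partial>pos_lborel) < ennreal \<epsilon>"
    by (rule order.strict_trans1[rotated])
  then have less: "enn2ereal (\<integral>\<^sup>+x. e2ennreal (?g x) \<partial>pos_lborel) < ereal \<epsilon>"
  proof -
    note less = \<open>(\<integral>\<^sup>+x. e2ennreal (?g x) \<partial>pos_lborel) < ennreal \<epsilon>\<close>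
    then have "\<epsilon> > 0" by (cases "\<epsilon> > 0") (auto simp: ennreal_neg)
    with less show ?thesis by (simp add: less_ennreal.rep_eq enn2ereal_ennreal)
  qed
  moreover have "log_ratio_integral p (\<lambda>x. enn2ereal (f x)) \<le> enn2ereal (\<integral>\<^sup>+x. e2ennreal (?g x) \<partial>pos_lborel)"
    unfolding log_ratio_integral_def ereal_integral_def by (rule ereal_diff_le_self) simp
  ultimately show ?thesis by (rule order.strict_trans1[rotated])
qed

text \<open>
  The excess of the log ratio over \<open>\<kappa>\<close> tends to 0 pointwise, hence in the integral by dominated
  convergence, and the remaining \<open>\<kappa>\<close> integrates to \<open>\<kappa> < \<epsilon>\<close>.
\<close>

lemma nn_integral_log_ratio_eventually_less:
  fixes f D :: "'a \<Rightarrow> real" and q :: "nat \<Rightarrow> 'a \<Rightarrow> real" and \<kappa> \<epsilon> :: real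
  assumes [measurable]: "f \<in> borel_measurable N" "\<And>n. q n \<in> borel_measurable N" "D \<in> borel_measurable N"
    and f: "\<And>x. x \<in> space N \<Longrightarrow> f x > 0" and density: "(\<integral>\<^sup>+x. ennreal (f x) \<partial>N) = 1"
    and q: "\<And>n x. x \<in> space N \<Longrightarrow> q n x > 0"
    and lower: "\<And>x y. x \<in> space N \<Longrightarrow> y < exp (- \<kappa>) * f x \<Longrightarrow> eventually (\<lambda>n. y < q n x) sequentially"
    and dom: "\<And>n x. x \<in> space N \<Longrightarrow> f x * max 0 (ln (f x / q n x)) \<le> D x"
    and D: "(\<integral>\<^sup>+x. ennreal (D x) \<partial>N) < \<infinity>"
    and \<kappa>: "0 \<le> \<kappa>" "\<kappa> < \<epsilon>"
  shows "eventually (\<lambda>n. (\<integral>\<^sup>+x. ennreal (f x * max 0 (ln (f x / q n x))) \<partial>N) < ennreal \<epsilon>) sequentially"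
proof -
  define r where "r = (\<lambda>n x. f x * max 0 (ln (f x / q n x) - \<kappa>))"
  have r_lim: "(\<lambda>n. r n x) \<longlonglongrightarrow> 0" if x: "x \<in> space N" for x
  proof -
    have "(\<lambda>n. max 0 (ln (f x / q n x) - \<kappa>)) \<longlonglongrightarrow> 0"
    proof (rule order_tendstoI)
      fix \<rho> :: real assume \<rho>: "0 < \<rho>"
      define y where "y = exp (- \<kappa>) * f x * exp (- \<rho>)"
      have y: "0 < y" "y < exp (- \<kappa>) * f x" using f[OF x] \<rho> by (auto simp: y_def)
      from lower[OF x y(2)]
      show "eventually (\<lambda>n. max 0 (ln (f x / q n x) - \<kappa>) < \<rho>) sequentially"
      proof eventually_elim
        case (elim n)
        have "ln (f x / q n x) < ln (f x / y)"
          using elim y f[OF x] by (intro ln_less_cancel_iff[THEN iffD2] divide_strict_left_mono) auto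
        also have "f x / y = exp (\<kappa> + \<rho>)"
          unfolding y_def exp_minus exp_add using f[OF x] by (simp add: field_simps)
        finally show ?case using \<rho> by simp
      qed
    qed (auto simp: less_max_iff_disj)
    then have "(\<lambda>n. f x * max 0 (ln (f x / q n x) - \<kappa>)) \<longlonglongrightarrow> f x * 0"
      by (rule tendsto_mult_left)
    then show ?thesis by (simp add: r_def)
  qed
  have r_bound: "r n x \<le> D x" if x: "x \<in> space N" for n x
  proof -
    have "r n x \<le> f x * max 0 (ln (f x / q n x))"
      unfolding r_def using f[OF x] \<kappa> by (intro mult_left_mono) auto
    then show ?thesis using dom[OF x, of n] by linarith
  qed
  have r_meas: "(\<lambda>x. ennreal (r n x)) \<in> borel_measurable N" for n
    unfolding r_def by measurable
  have "(\<lambda>n. \<integral>\<^sup>+x. ennreal (r n x) \<partial>N) \<longlonglongrightarrow> (\<integral>\<^sup>+x. 0 \<partial>N)"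
  proof (rule nn_integral_dominated_convergence[OF r_meas _ _ _ D])
    show "AE x in N. ennreal (r n x) \<le> ennreal (D x)" for n
      using r_bound by (intro AE_I2 ennreal_leI)
    show "AE x in N. (\<lambda>n. ennreal (r n x)) \<longlonglongrightarrow> 0"
      using r_lim by (intro AE_I2 tendsto_ennrealI[of _ 0, simplified])
  qed auto
  then have "eventually (\<lambda>n. (\<integral>\<^sup>+x. ennreal (r n x) \<partial>N) < ennreal (\<epsilon> - \<kappa>)) sequentially"
    using \<kappa> by (intro order_tendstoD(2)) auto
  then show ?thesis
  proof eventually_elim
    case (elim n)
    have "(\<integral>\<^sup>+x. ennreal (f x * max 0 (ln (f x / q n x))) \<partial>N) \<le>
        (\<integral>\<^sup>+x. ennreal (r n x) + ennreal \<kappa> * ennreal (f x) \<partial>N)"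
    proof (rule nn_integral_mono)
      fix x assume x: "x \<in> space N"
      have "f x * max 0 (ln (f x / q n x)) \<le> f x * (max 0 (ln (f x / q n x) - \<kappa>) + \<kappa>)"
        using f[OF x] \<kappa> by (intro mult_left_mono) auto
      also have "\<dots> = r n x + \<kappa> * f x" by (simp add: r_def algebra_simps)
      finally show "ennreal (f x * max 0 (ln (f x / q n x))) \<le>
          ennreal (r n x) + ennreal \<kappa> * ennreal (f x)"
        using f[OF x] \<kappa> by (simp add: r_def ennreal_leI flip: ennreal_mult' ennreal_plus)
    qed
    also have "\<dots> = (\<integral>\<^sup>+x. ennreal (r n x) \<partial>N) + ennreal \<kappa>"
      using r_meas density by (subst nn_integral_add) (auto simp: nn_integral_cmult)
    also have "\<dots> < ennreal (\<epsilon> - \<kappa>) + ennreal \<kappa>"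
      using elim by (simp add: add.commute[of _ "ennreal \<kappa>"] ennreal_add_left_cancel_less)
    also have "\<dots> = ennreal \<epsilon>"
      using \<kappa> by (simp flip: ennreal_plus)
    finally show ?case .
  qed
qed

text \<open>
  This is where the moment condition enters: up to a factor, its weight dominates \<open>3 x + 7 / x\<close>,
  the growth of minus the logarithm of the lower bound for the kernel.
\<close>

lemma linear_reciprocal_moments_finite:
  fixes f0 :: "real \<Rightarrow> real"
  assumes f [measurable]: "f0 \<in> borel_measurable pos_lborel"
    and pos: "\<And>x. x > 0 \<Longrightarrow> f0 x \<ge> 0"
    and finite: "(\<integral>\<^sup>+x. ennreal (f0 x) \<partial>pos_lborel) < \<infinity>"
    and \<eta>: "\<eta> > 0" and moments: "(\<integral>\<^sup>+x\<in>{0<..}.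
               ennreal (max (x powr (- \<eta> - 2)) (x powr (\<eta> + 2)) * f0 x) \<partial>lborel) < \<infinity>"
    and c: "c \<ge> 0"
  shows "(\<integral>\<^sup>+x. ennreal (f0 x * (c + 3 * x + 7 / x)) \<partial>pos_lborel) < \<infinity>"
proof -
  let ?m = "\<lambda>x. max (x powr (- \<eta> - 2)) (x powr (\<eta> + 2))"
  have id [measurable]: "(\<lambda>x. x) \<in> borel_measurable pos_lborel"
    by (intro measurable_restrict_space1) simp
  have le: "3 * x + 7 / x \<le> 10 * ?m x" if x: "x > 0" for x :: real
  proof (cases "x \<ge> 1")
    case True
    have "x powr 1 \<le> x powr (\<eta> + 2)" using True \<eta> by (intro powr_mono) auto
    moreover have "7 / x \<le> 7" using True by (simp add: field_simps)
    ultimately have "3 * x + 7 / x \<le> 10 * x powr (\<eta> + 2)" using x True by simp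
    then show ?thesis by linarith
  next
    case False
    have "x powr (- 1) \<le> x powr (- \<eta> - 2)" using False x \<eta> by (intro powr_mono') auto
    moreover have "3 * x + 7 / x \<le> 10 * x powr (- 1)"
    proof -
      have "x * x \<le> 1" using False x by (intro mult_le_one) auto
      then show ?thesis using x by (simp add: powr_minus field_simps)
    qed
    ultimately have "3 * x + 7 / x \<le> 10 * x powr (- \<eta> - 2)" by linarith
    then show ?thesis by linarith
  qed
  have "(\<integral>\<^sup>+x. ennreal (f0 x * (c + 3 * x + 7 / x)) \<partial>pos_lborel) \<le>
      (\<integral>\<^sup>+x. ennreal c * ennreal (f0 x) + 10 * ennreal (?m x * f0 x) \<partial>pos_lborel)"
  proof (rule nn_integral_mono)
    fix x assume "x \<in> space pos_lborel"
    then have x: "x > 0" by (simp add: space_restrict_space)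
    have "f0 x * (3 * x + 7 / x) \<le> f0 x * (10 * ?m x)"
      using le[OF x] pos[OF x] by (rule mult_left_mono)
    then have "f0 x * (c + 3 * x + 7 / x) \<le> c * f0 x + 10 * (?m x * f0 x)"
      by (simp add: algebra_simps)
    moreover have "?m x * f0 x \<ge> 0" using pos[OF x] by (simp add: le_max_iff_disj)
    ultimately have "ennreal (f0 x * (c + 3 * x + 7 / x)) \<le> ennreal (c * f0 x) + ennreal (10 * (?m x * f0 x))"
      using pos[OF x] c by (simp add: ennreal_leI flip: ennreal_plus)
    then show "ennreal (f0 x * (c + 3 * x + 7 / x)) \<le> ennreal c * ennreal (f0 x) + 10 * ennreal (?m x * f0 x)"
      using c \<open>?m x * f0 x \<ge> 0\<close> by (simp add: ennreal_mult' del: max.bounded_iff)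
  qed
  also have "\<dots> = ennreal c * (\<integral>\<^sup>+x. ennreal (f0 x) \<partial>pos_lborel) +
      10 * (\<integral>\<^sup>+x. ennreal (?m x * f0 x) \<partial>pos_lborel)"
    by (simp add: nn_integral_add nn_integral_cmult)
  also have "\<dots> < \<infinity>"
    using finite moments by (simp add: ennreal_mult_less_top nn_integral_pos_lborel)
  finally show ?thesis .
qed

section \<open>Small divergence on a weak neighbourhood\<close>

lemma cutoff_kernel_measurable:
  "(\<lambda>(x, s). cutoff n s * inverse_gamma_kernel x (fst s) (snd s)) \<in>
     borel_measurable (pos_lborel \<Otimes>\<^sub>M restrict_space borel quadrant)"
proof -
  have "cutoff n \<in> borel_measurable borel"
    unfolding cutoff_def[abs_def] by (intro borel_measurable_continuous_onI continuous_intros)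
  then have "(\<lambda>p. cutoff n (snd p)) \<in> borel_measurable (pos_lborel \<Otimes>\<^sub>M restrict_space borel quadrant)"
    by (intro measurable_compose[OF measurable_snd] measurable_restrict_space1)
  then show ?thesis
    using inverse_gamma_kernel_measurable by (simp add: case_prod_beta')
qed

text \<open>
  The centre of the neighbourhood is the measure \<open>P\<^sub>n\<close>, for a large \<open>n\<close>, that has an atom of
  mass \<open>1 - e\<close> at \<open>(3/2, 3/2)\<close> and lets \<open>z\<close> follow \<open>f0\<close> on the line \<open>k = n\<close>, with \<open>e = exp (- \<epsilon> / 2)\<close>.
  The line reproduces \<open>e f0\<close> in the limit; the atom supplies a lower bound that is the same for all
  \<open>n\<close>, which is what dominated convergence needs.
\<close>

lemma mixture_approximation:
  fixes f0 :: "real \<Rightarrow> real"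
  assumes cont: "continuous_on {0<..} f0" and pos: "\<And>x. x > 0 \<Longrightarrow> 0 < f0 x"
    and M: "\<And>x. x > 0 \<Longrightarrow> f0 x \<le> M"
    and density: "(\<integral>\<^sup>+x. ennreal (f0 x) \<partial>pos_lborel) = 1"
    and moments: "\<And>c. c \<ge> 0 \<Longrightarrow>
      (\<integral>\<^sup>+x. ennreal (f0 x * (c + 3 * x + 7 / x)) \<partial>pos_lborel) < \<infinity>"
    and \<epsilon>: "\<epsilon> > 0"
  obtains P0 U where "P0 \<in> prob_measures quadrant" "openin (weak_topology quadrant) U" "P0 \<in> U"
    "\<And>P. P \<in> U \<Longrightarrow> P \<in> prob_measures quadrant"
    "\<And>P. P \<in> U \<Longrightarrow> log_ratio_integral f0 (\<lambda>x. enn2ereal (mixture P x)) < ereal \<epsilon>"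
proof -
  have f0 [measurable]: "f0 \<in> borel_measurable pos_lborel"
    by (rule borel_measurable_pos_lborel[OF cont])
  have id [measurable]: "(\<lambda>x. x) \<in> borel_measurable pos_lborel"
    by (intro measurable_restrict_space1) simp
  obtain G where G: "G > 0" "\<And>x k z. x > 0 \<Longrightarrow> k \<in> {1..2} \<Longrightarrow> z \<in> {1..2} \<Longrightarrow>
       exp (- (3 * x + 7 / x)) / G \<le> inverse_gamma_kernel x k z"
    using inverse_gamma_kernel_lower_bound by blast
  \<comment> \<open>A mixture that is only \<open>e f0\<close> in the limit costs \<open>- ln e = \<epsilon> / 2\<close>.\<close>
  define e where "e = exp (- (\<epsilon> / 2))"
  have e: "0 < e" "e < 1" using \<epsilon> by (auto simp: e_def)
  let ?R = "restrict_space (borel :: (real \<times> real) measure) quadrant"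
  define good where "good = (\<lambda>n P. P \<in> prob_measures quadrant \<and> (\<forall>g \<in> borel_measurable ?R.
     (\<integral>\<^sup>+t. g t \<partial>P) = ennreal (1 - e) * g (3 / 2, 3 / 2) +
       ennreal e * (\<integral>\<^sup>+z. ennreal (f0 z) * g (real n, z) \<partial>pos_lborel)))"
  have "\<exists>P. good n P" if "n > 0" for n
  proof -
    have "(3 / 2, 3 / 2) \<in> quadrant" by simp
    from atom_plus_line_measure[OF f0 density _ this, of "real n" "1 - e"] that e
    obtain P where "P \<in> prob_measures quadrant" "\<And>g. g \<in> borel_measurable ?R \<Longrightarrow>
        (\<integral>\<^sup>+t. g t \<partial>P) = ennreal (1 - e) * g (3 / 2, 3 / 2) +
          ennreal e * (\<integral>\<^sup>+z. ennreal (f0 z) * g (real n, z) \<partial>pos_lborel)"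
      by auto
    then show ?thesis unfolding good_def by blast
  qed
  then obtain P0 where good: "\<And>n. n > 0 \<Longrightarrow> good n (P0 n)" by metis
  have P0: "P0 n \<in> prob_measures quadrant" if "n > 0" for n
    using good[OF that] by (simp add: good_def)
  have int_P0: "(\<integral>\<^sup>+t. g t \<partial>P0 n) = ennreal (1 - e) * g (3 / 2, 3 / 2) +
       ennreal e * (\<integral>\<^sup>+z. ennreal (f0 z) * g (real n, z) \<partial>pos_lborel)"
    if "n > 0" "g \<in> borel_measurable ?R" for n g
    using good[OF that(1)] that(2) by (simp add: good_def)
  have sets_P0: "sets (P0 n) = sets ?R" if "n > 0" for n
    using prob_measuresD(2)[OF P0[OF that]] .
  \<comment> \<open>The atom has mass \<open>1 - e\<close>; half of it is left in a neighbourhood.\<close>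
  define b where "b = (1 - e) / 2"
  have b: "b > 0" using e by (simp add: b_def)
  have bump_P0: "(\<integral>s. bump s \<partial>P0 n) > b" if n: "n > 0" for n
  proof -
    have "bump \<in> borel_measurable ?R"
      by (intro borel_measurable_continuous_on_restrict bump_continuous_bounded)
    then have "(\<lambda>s. ennreal (bump s)) \<in> borel_measurable ?R" by simp
    from int_P0[OF n this]
    have "ennreal (1 - e) \<le> (\<integral>\<^sup>+s. ennreal (bump s) \<partial>P0 n)"
      by (simp add: bump_def)
    also have "\<dots> = ennreal (\<integral>s. bump s \<partial>P0 n)"
      using integrable_prob_measures[OF P0[OF n] bump_continuous_bounded] bump_bounds
      by (intro nn_integral_eq_integral) auto
    finally have "1 - e \<le> (\<integral>s. bump s \<partial>P0 n)"
      using bump_bounds by (simp add: ennreal_le_iff integral_nonneg_AE)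
    then show ?thesis using e by (simp add: b_def)
  qed
  define W where "W = (\<lambda>x::real. exp (- (3 * x + 7 / x)) / G)"
  have W: "W x > 0" for x using G(1) by (simp add: W_def)
  define h where "h = (\<lambda>n x s. cutoff n s * inverse_gamma_kernel x (fst s) (snd s))"
  define F where "F = (\<lambda>n x. \<integral>s. h n x s \<partial>P0 n)"
  \<comment> \<open>\<open>q n\<close> is the lower bound valid for all mixing measures in a neighbourhood of \<open>P0 n\<close>.\<close>
  define q where "q = (\<lambda>n x. max (b * W x) (if x \<in> {1 / real n..real n} then F n x - 1 / real n else 0))"
  have q: "b * W x \<le> q n x" "q n x > 0" for n x
    using b W[of x] by (auto simp: q_def less_max_iff_disj)
  have h_meas: "(\<lambda>(x, s). h n x s) \<in> borel_measurable (pos_lborel \<Otimes>\<^sub>M ?R)" for n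
    unfolding h_def by (rule cutoff_kernel_measurable)
  have F_meas [measurable]: "F n \<in> borel_measurable pos_lborel" if "n > 0" for n
  proof -
    interpret P: prob_space "P0 n" using prob_measuresD(1)[OF P0[OF that]] .
    have "sets (pos_lborel \<Otimes>\<^sub>M P0 n) = sets (pos_lborel \<Otimes>\<^sub>M ?R)"
      using sets_P0[OF that] by (intro sets_pair_measure_cong) auto
    then have "(\<lambda>(x, s). h n x s) \<in> borel_measurable (pos_lborel \<Otimes>\<^sub>M P0 n)"
      using h_meas by (simp cong: measurable_cong_sets)
    then show ?thesis
      unfolding F_def by (rule P.borel_measurable_lebesgue_integral)
  qed
  have q_meas [measurable]: "q n \<in> borel_measurable pos_lborel" if "n > 0" for n
    unfolding q_def W_def using F_meas[OF that] by measurable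
  have F_lower: "eventually (\<lambda>n. e * (f0 x - \<theta>) \<le> F n x) sequentially" if x: "x > 0" and \<theta>: "\<theta> > 0" for x \<theta>
  proof -
    have "eventually (\<lambda>n. ennreal (f0 x - \<theta>) \<le> (\<integral>\<^sup>+z. ennreal (cutoff n (real n, z) *
        inverse_gamma_kernel x n z * f0 z) \<partial>pos_lborel)) sequentially"
      using cont pos x \<theta> by (intro inverse_gamma_kernel_smoothing_limit) (auto intro: less_imp_le)
    then show ?thesis
      using eventually_gt_at_top[of 0]
    proof eventually_elim
      case (elim n)
      have h_meas_s: "h n x \<in> borel_measurable ?R"
        using measurable_compose[OF measurable_Pair1' h_meas[of n], of x] x
        by (simp add: space_restrict_space)
      have h_nonneg: "h n x s \<ge> 0" if "s \<in> space (P0 n)" for s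
        using that prob_measuresD(3)[OF P0[OF elim(2)]] cutoff_bounds
        by (auto simp: h_def intro!: mult_nonneg_nonneg inverse_gamma_kernel_nonneg)
      have "ennreal (e * (f0 x - \<theta>)) = ennreal e * ennreal (f0 x - \<theta>)"
        using e by (simp add: ennreal_mult')
      also have "\<dots> \<le> ennreal e * (\<integral>\<^sup>+z. ennreal (f0 z) * ennreal (h n x (real n, z)) \<partial>pos_lborel)"
      proof (intro mult_left_mono order.trans[OF elim(1)] nn_integral_mono)
        fix z assume "z \<in> space pos_lborel"
        then have "z > 0" by (simp add: space_restrict_space)
        then show "ennreal (cutoff n (real n, z) * inverse_gamma_kernel x (real n) z * f0 z) \<le>
            ennreal (f0 z) * ennreal (h n x (real n, z))"
          using pos[of z] by (simp add: h_def mult.commute flip: ennreal_mult')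
      qed simp
      also have "\<dots> \<le> (\<integral>\<^sup>+s. ennreal (h n x s) \<partial>P0 n)"
        using int_P0[OF elim(2), of "\<lambda>s. ennreal (h n x s)"] h_meas_s by simp
      finally have le: "ennreal (e * (f0 x - \<theta>)) \<le> (\<integral>\<^sup>+s. ennreal (h n x s) \<partial>P0 n)" .
      show "e * (f0 x - \<theta>) \<le> F n x"
      proof -
        have "(\<integral>\<^sup>+s. ennreal (h n x s) \<partial>P0 n) = ennreal (F n x)"
          unfolding F_def h_def
          using cutoff_kernel_continuous_bounded[OF elim(2) x] P0[OF elim(2)] h_nonneg
          by (intro nn_integral_eq_integral integrable_prob_measures[of _ quadrant]) (auto simp: h_def)
        moreover have "F n x \<ge> 0"
          unfolding F_def using h_nonneg by (intro integral_nonneg_AE) auto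
        ultimately show ?thesis using le by (simp add: ennreal_le_iff)
      qed
    qed
  qed
  have q_lower: "eventually (\<lambda>n. y < q n x) sequentially" if x: "x > 0" and y: "y < e * f0 x" for x y
  proof -
    \<comment> \<open>Half of the gap \<open>e f0 x - y\<close> is left for the error \<open>1 / n\<close>.\<close>
    define \<theta> where "\<theta> = (e * f0 x - y) / (2 * e)"
    have \<theta>: "\<theta> > 0" "e * (f0 x - \<theta>) = (e * f0 x + y) / 2"
      using y e by (auto simp: \<theta>_def field_simps)
    have "(e * f0 x - y) / 2 > 0" using y by simp
    then have "eventually (\<lambda>n. 1 / real n < (e * f0 x - y) / 2) sequentially"
      by real_asymp
    moreover have "eventually (\<lambda>n. x \<in> {1 / real n..real n}) sequentially"
    proof -
      have "eventually (\<lambda>n. 1 / real n \<le> x) sequentially" "eventually (\<lambda>n. x \<le> real n) sequentially"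
        using x by real_asymp+
      then show ?thesis by eventually_elim simp
    qed
    ultimately show ?thesis
      using F_lower[OF x \<theta>(1)]
    proof eventually_elim
      case (elim n)
      then have "y < F n x - 1 / real n" using \<theta>(2) by (simp add: field_simps)
      then show ?case using elim(2) by (simp add: q_def less_max_iff_disj)
    qed
  qed
  define c where "c = \<bar>ln (M * G / b)\<bar>"
  have "M > 0" using pos[of 1] M[of 1] by simp
  have dom: "f0 x * max 0 (ln (f0 x / q n x)) \<le> f0 x * (c + 3 * x + 7 / x)" if x: "x > 0" for n x
  proof -
    have "f0 x / q n x \<le> M / (b * W x)"
      using M[OF x] q[where n = n and x = x] pos[OF x] b W[of x] by (intro frac_le) auto
    then have "ln (f0 x / q n x) \<le> ln (M / (b * W x))"
      using pos[OF x] q(2)[of n x] by (intro ln_mono) auto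
    also have "M / (b * W x) = M * G / b * exp (3 * x + 7 / x)"
      unfolding W_def exp_minus by (simp add: divide_inverse mult_ac)
    also have "ln \<dots> = ln (M * G / b) + (3 * x + 7 / x)"
      using \<open>M > 0\<close> G(1) b by (subst ln_mult) auto
    finally have "ln (f0 x / q n x) \<le> c + 3 * x + 7 / x" by (simp add: c_def)
    moreover have "0 \<le> c + 3 * x + 7 / x" using x by (simp add: c_def)
    ultimately show ?thesis
      using pos[OF x] by (intro mult_left_mono) auto
  qed
  \<comment> \<open>The index is shifted because \<open>P0 n\<close> is specified for \<open>n > 0\<close> only.\<close>
  have "eventually (\<lambda>m. (\<integral>\<^sup>+x. ennreal (f0 x * max 0 (ln (f0 x / q (Suc m) x))) \<partial>pos_lborel) < ennreal \<epsilon>)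
      sequentially"
  proof (rule nn_integral_log_ratio_eventually_less)
    show "\<epsilon> / 2 < \<epsilon>" using \<epsilon> by simp
    show "(\<integral>\<^sup>+x. ennreal (f0 x * (c + 3 * x + 7 / x)) \<partial>pos_lborel) < \<infinity>"
      by (rule moments) (simp add: c_def)
    fix x assume "x \<in> space pos_lborel"
    then have x: "x > 0" by (simp add: space_restrict_space)
    show "eventually (\<lambda>m. y < q (Suc m) x) sequentially" if "y < exp (- (\<epsilon> / 2)) * f0 x" for y
      using q_lower[OF x, of y] that eventually_sequentially_Suc[of "\<lambda>n. y < q n x"] by (simp add: e_def)
    show "f0 x > 0" by (rule pos[OF x])
    show "f0 x * max 0 (ln (f0 x / q (Suc m) x)) \<le> f0 x * (c + 3 * x + 7 / x)" for m
      by (rule dom[OF x])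
  qed (use density \<epsilon> q in auto)
  then obtain m where m: "(\<integral>\<^sup>+x. ennreal (f0 x * max 0 (ln (f0 x / q (Suc m) x))) \<partial>pos_lborel) < ennreal \<epsilon>"
    by (auto simp: eventually_sequentially)
  define n where "n = Suc m"
  have n: "n > 0" by (simp add: n_def)
  have "1 / real n > 0" using n by simp
  from weak_neighborhood_mixture_lower_bound[OF P0[OF n] n this bump_P0[OF n] G]
  obtain U where U: "openin (weak_topology quadrant) U" "P0 n \<in> U"
    "\<And>P. P \<in> U \<Longrightarrow> P \<in> prob_measures quadrant"
    "\<And>P x. P \<in> U \<Longrightarrow> x > 0 \<Longrightarrow> ennreal (b * W x) \<le> mixture P x"
    "\<And>P x. P \<in> U \<Longrightarrow> x \<in> {1 / real n..real n} \<Longrightarrow> ennreal (F n x - 1 / real n) \<le> mixture P x"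
    unfolding W_def F_def h_def by blast
  show thesis
  proof (rule that[OF P0[OF n] U(1,2,3)])
    fix P assume P: "P \<in> U"
    show "log_ratio_integral f0 (\<lambda>x. enn2ereal (mixture P x)) < ereal \<epsilon>"
    proof (rule log_ratio_integral_less[OF pos q(2)[where n = n] _ m[folded n_def]])
      fix x :: real assume x: "x > 0"
      show "ennreal (q n x) \<le> mixture P x"
        using U(4,5)[OF P, of x] x by (auto simp: q_def max_def)
    qed
  qed
qed

theorem theorem15:
  fixes Q :: "(real \<times> real) measure measure" and f0 :: "real \<Rightarrow> real"
  assumes prior: "is_prior ({0<..} \<times> {0<..}) Q"
    and full_support: "prob_measures ({0<..} \<times> {0<..}) \<subseteq> weak_support ({0<..} \<times> {0<..}) Q"
    and f0_cont: "continuous_on {0..} f0"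
    and f0_bounded: "bounded (f0 ` {0..})"
    and f0_nonneg: "\<And>x. x \<ge> 0 \<Longrightarrow> f0 x \<ge> 0"
    and f0_density: "(\<integral>\<^sup>+x\<in>{0..}. ennreal (f0 x) \<partial>lborel) = 1"
    and B4: "\<exists>M>0. \<forall>x>0. 0 < f0 x \<and> f0 x \<le> M"
    and B5: "\<bar>ereal_integral pos_lborel (\<lambda>x. ereal (f0 x * ln (f0 x)))\<bar> < \<infinity>"
    and B6: "\<exists>\<delta>>0. log_ratio_integral f0 (\<lambda>x. ereal (local_inf f0 \<delta> x)) < \<infinity>"
    and B7: "\<exists>\<eta>>0. (\<integral>\<^sup>+x\<in>{0<..}.
               ennreal (max (x powr (- \<eta> - 2)) (x powr (\<eta> + 2)) * f0 x) \<partial>lborel) < \<infinity>"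
  shows "f0 \<in> KL_support (induced_prior Q)"
proof -
  obtain M where M: "\<And>x. x > 0 \<Longrightarrow> 0 < f0 x" "\<And>x. x > 0 \<Longrightarrow> f0 x \<le> M"
    using B4 by blast
  have cont: "continuous_on {0<..} f0"
    by (rule continuous_on_subset[OF f0_cont]) auto
  have f0: "f0 \<in> borel_measurable pos_lborel"
    by (rule borel_measurable_pos_lborel[OF cont])
  have "(\<integral>\<^sup>+x. ennreal (f0 x) \<partial>pos_lborel) = (\<integral>\<^sup>+x\<in>{0..}. ennreal (f0 x) \<partial>lborel)"
    unfolding nn_integral_pos_lborel
    by (intro nn_integral_cong_AE eventually_mono[OF AE_lborel_singleton[of 0]])
      (auto simp: indicator_def)
  then have density: "(\<integral>\<^sup>+x. ennreal (f0 x) \<partial>pos_lborel) = 1"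
    using f0_density by simp
  obtain \<eta> where "\<eta> > 0" "(\<integral>\<^sup>+x\<in>{0<..}.
      ennreal (max (x powr (- \<eta> - 2)) (x powr (\<eta> + 2)) * f0 x) \<partial>lborel) < \<infinity>"
    using B7 by blast
  from linear_reciprocal_moments_finite[OF f0 less_imp_le[OF M(1)] _ this] density
  have moments: "(\<integral>\<^sup>+x. ennreal (f0 x * (c + 3 * x + 7 / x)) \<partial>pos_lborel) < \<infinity>" if "c \<ge> 0" for c
    using that by simp
  have "emeasure (induced_prior Q) {f \<in> space (induced_prior Q).
      log_ratio_integral f0 (\<lambda>x. enn2ereal (f x)) < ereal \<epsilon>} > 0" if \<epsilon>: "\<epsilon> > 0" for \<epsilon>
  proof -
    let ?A = "{f \<in> densities. log_ratio_integral f0 (\<lambda>x. enn2ereal (f x)) < ereal \<epsilon>}"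
    obtain P0 U where U: "P0 \<in> prob_measures quadrant" "openin (weak_topology quadrant) U" "P0 \<in> U"
      "\<And>P. P \<in> U \<Longrightarrow> P \<in> prob_measures quadrant"
      "\<And>P. P \<in> U \<Longrightarrow> log_ratio_integral f0 (\<lambda>x. enn2ereal (mixture P x)) < ereal \<epsilon>"
      using mixture_approximation[OF cont M density moments \<epsilon>] by blast
    have space: "space Q = prob_measures quadrant" using prior by (simp add: is_prior_def)
    note log_ratio_integral_mixture_measurable[OF prior f0, measurable]
    have "mixture -` ?A \<inter> space Q =
        {P \<in> space Q. log_ratio_integral f0 (\<lambda>x. enn2ereal (mixture P x)) < ereal \<epsilon>}"
      using mixture_in_densities space by auto
    also have "\<dots> \<in> sets Q" by measurable
    finally have A: "mixture -` ?A \<inter> space Q \<in> sets Q" .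
    have "0 < emeasure Q U"
      using full_support U(1,2,3) by (auto simp: weak_support_def)
    also have "emeasure Q U \<le> emeasure Q (mixture -` ?A \<inter> space Q)"
      using U(4,5) space mixture_in_densities by (intro emeasure_mono A) auto
    also have "\<dots> = emeasure (induced_prior Q) ?A"
      by (rule emeasure_induced_prior[OF prior _ A, symmetric]) auto
    finally show ?thesis
      by (simp add: space_induced_prior[OF prior])
  qed
  then show ?thesis by (simp add: KL_support_def)
qed

end
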